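(* Let $d\ge 1$, let $0<K<1$, and let $\pi,\eta$ be two $K$-subgaussian probability distributions on $\mathbb{R}^d$. Then $$\mathrm{KL}(f_\pi\|f_\eta)\le 1660056\left(\frac{1}{(1-K)^3}\vee 8d^3\right)H^2(f_\pi,f_\eta).$$
   Context: For $K>0$, a probability distribution $\pi$ on $\mathbb{R}^d$ is called $K$-subgaussian if for $X\sim\pi$ one has $\mathbf{P}[\|X\|_2>t]\le\exp\left(-\frac{t^2}{2K^2}\right)$ for all $t\ge 0$. For a probability distribution $\pi$ on $\mathbb{R}^d$, $f_\pi=\pi*\varphi$ denotes the Gaussian mixture density $f_\pi(x)=\int_{\mathbb{R}^d}\varphi(x-z)\,\pi(dz)$, where $\varphi(z)=(2\pi)^{-d/2}\exp(-\|z\|_2^2/2)$ is the density of $\mathcal{N}(0,I_d)$. For densities $f,g$: $\mathrm{KL}(f\|g)=\int f\log\frac{f}{g}$ (natural logarithm) and $H^2(f,g)=\int(\sqrt f-\sqrt g)^2$. Notation: $a\vee b=\max(a,b)$. *)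

theory Defs
  imports "HOL-Probability.Probability"
begin

definition subgaussian :: "real \<Rightarrow> (real ^ 'n) measure \<Rightarrow> bool" where
  "subgaussian K \<pi> \<longleftrightarrow>
     (\<forall>t\<ge>0. measure \<pi> {x. norm x > t} \<le> exp (- (t\<^sup>2 / (2 * K\<^sup>2))))"

definition gauss_density :: "real ^ 'n \<Rightarrow> real" where
  "gauss_density z = (2 * pi) powr (- (real CARD('n) / 2)) * exp (- ((norm z)\<^sup>2 / 2))"

definition gauss_mixture :: "(real ^ 'n) measure \<Rightarrow> real ^ 'n \<Rightarrow> real" where
  "gauss_mixture \<pi> x = (LINT z|\<pi>. gauss_density (x - z))"

definition KL_integrand :: "real \<Rightarrow> real \<Rightarrow> ereal" where
  "KL_integrand a b =
     (if a = 0 then 0 else if b = 0 then \<infinity> else ereal (a * ln (a / b)))"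

(* The integral of f log (f/g) as an extended real (positive part minus negative part).
   A Bochner integral would silently give 0 when the divergence is infinite.  For probability
   densities the negative part is at most 1, since a ln (a/b) >= a - b for a, b > 0, so the
   difference is never of the form infinity - infinity. *)
definition KL_div :: "('a::euclidean_space \<Rightarrow> real) \<Rightarrow> ('a \<Rightarrow> real) \<Rightarrow> ereal" where
  "KL_div f g =
     enn2ereal (\<integral>\<^sup>+ x. e2ennreal (KL_integrand (f x) (g x)) \<partial>lborel) -
     enn2ereal (\<integral>\<^sup>+ x. e2ennreal (- KL_integrand (f x) (g x)) \<partial>lborel)"

(* (sqrt f - sqrt g)^2 <= f + g, so the integral exists for probability densities. *)
definition hellinger_sq :: "('a::euclidean_space \<Rightarrow> real) \<Rightarrow> ('a \<Rightarrow> real) \<Rightarrow> real" where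
  "hellinger_sq f g = (LINT x|lborel. (sqrt (f x) - sqrt (g x))\<^sup>2)"

lemma KL_div_eq_integral:
  assumes g: "\<And>x. g x > 0" and int: "integrable lborel (\<lambda>x. f x * ln (f x / g x))"
  shows "KL_div f g = ereal (LINT x|lborel. f x * ln (f x / g x))"
proof -
  let ?h = "\<lambda>x. f x * ln (f x / g x)"
  have h: "KL_integrand (f x) (g x) = ereal (?h x)" for x
    using g[of x] by (auto simp: KL_integrand_def)
  have fin: "(\<integral>\<^sup>+ x. ennreal (?h x) \<partial>lborel) \<noteq> top" "(\<integral>\<^sup>+ x. ennreal (- ?h x) \<partial>lborel) \<noteq> top"
    using integrableD(2,3)[OF int] by simp_all
  have ex: "\<exists>r\<ge>0. y = ennreal r" if "y \<noteq> top" for y :: ennreal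
    using that by (cases y) auto
  from ex[OF fin(1)] obtain p where
    p: "p \<ge> 0" "(\<integral>\<^sup>+ x. ennreal (?h x) \<partial>lborel) = ennreal p" by (elim exE conjE)
  from ex[OF fin(2)] obtain q where
    q: "q \<ge> 0" "(\<integral>\<^sup>+ x. ennreal (- ?h x) \<partial>lborel) = ennreal q" by (elim exE conjE)
  have "KL_div f g = ereal p - ereal q"
    unfolding KL_div_def h uminus_ereal.simps e2ennreal_ereal p q
    using p(1) q(1) by (simp only: enn2ereal_ennreal)
  moreover have "(LINT x|lborel. ?h x) = p - q"
    unfolding real_lebesgue_integral_def[OF int] p q using p(1) q(1) by simp
  ultimately show ?thesis by simp
qed

end

theory Submission
  imports Defs
begin

text \<open>
  Write \<open>f\<close> and \<open>g\<close> for the two mixture densities, \<open>L = ln (f / g)\<close> for the log-likelihood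
  ratio and \<open>h = (sqrt f - sqrt g)\<^sup>2\<close> for the Hellinger integrand. Since \<open>f\<close> and \<open>g\<close> have the same
  integral, the divergence is the integral of \<open>f L - f + g\<close>, and pointwise this is at most
  \<open>(3 + max 0 L) h\<close>. So the divergence can exceed the Hellinger distance only through the region
  where \<open>L\<close> is large, and it remains to bound the integral of \<open>max 0 L * h\<close> by that of \<open>h\<close>.

  The reason why such a bound holds without a logarithmic loss is that for \<open>K < 1\<close> the mixture flows
  inwards: by Tweedie's formula the radial derivative \<open>x \<bullet> \<nabla>f\<close> equals
  \<open>f * (x \<bullet> E[Z | x] - |x|\<^sup>2)\<close>, where \<open>E[Z | x]\<close> is the mean of the mixing variable \<open>Z\<close> under the
  posterior given the observation \<open>x\<close>. Subgaussianity with \<open>K < 1\<close> makes a mixing mass near \<open>x\<close> rarer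
  than a Gaussian fluctuation of size \<open>|x|\<close>, so that \<open>x \<bullet> E[Z | x] \<le> (1 - \<epsilon>) |x|\<^sup>2 + C\<close>: the density
  decays along rays at a Gaussian rate, whereas \<open>L\<close> changes at the rate
  \<open>x \<bullet> (E[Z | x] - E'[Z | x]) = O(|x|\<^sup>2 + C)\<close> only.

  This is turned into an integral inequality by a virial identity. Dilation invariance of Lebesgue
  measure gives that the integral of \<open>d H + x \<bullet> \<nabla>H\<close> vanishes for every integrable \<open>H\<close> whose radial
  derivative is integrable (\<open>dilation_identity\<close>). Apply this to \<open>H = w f \<psi>(L)\<close>, where
  \<open>\<psi>(L) = max 0 L * (1 - exp (- L / 2))\<^sup>2\<close>, so that \<open>f \<psi>(L) = max 0 L * h\<close> and \<open>f \<psi>'(L) \<le> 3 h\<close>, and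
  where the weight \<open>w = 1 / (|x|\<^sup>2 + D\<^sup>3)\<close> cancels the factor \<open>|x|\<^sup>2\<close> in both rates. Outside a ball of
  squared radius of order \<open>D\<^sup>3\<close> the inward drift dominates and controls \<open>max 0 L * h\<close> by a multiple
  of \<open>h\<close>; inside it \<open>L\<close> is itself bounded by a multiple of \<open>D\<^sup>3\<close>. The pointwise form of this argument
  is \<open>flux_bound\<close>, its integrated form \<open>hellinger_log_moment\<close>.

  All estimates are expressed in the single parameter \<open>D = max (1 / (1 - K)) (2 * d)\<close>. Enlarging \<open>K\<close>
  to \<open>1 - 1 / D\<close> costs nothing and makes \<open>1 / (1 - K) = D\<close>, \<open>d \<le> D / 2\<close> and \<open>D \<ge> 2\<close>. The resulting
  constant is \<open>460 * D\<^sup>3\<close>.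
\<close>

section \<open>Radial derivatives and the dilation identity\<close>

text \<open>
  \<open>E\<close> is the image of \<open>H\<close> under the Euler operator \<open>x \<bullet> \<nabla>\<close>. Only differentiability along rays is
  demanded, since dilations move points along rays.
\<close>
definition euler_deriv :: "('a::real_vector \<Rightarrow> real) \<Rightarrow> ('a \<Rightarrow> real) \<Rightarrow> bool" where
  "euler_deriv H E \<longleftrightarrow> (\<forall>x. ((\<lambda>s. H (s *\<^sub>R x)) has_real_derivative E x) (at 1))"

lemma euler_derivD:
  assumes "euler_deriv H E" "s > 0"
  shows "((\<lambda>r. H (r *\<^sub>R x)) has_real_derivative E (s *\<^sub>R x) / s) (at s)"
proof -
  have "s / s = 1" using assms(2) by simp
  then have 1: "((\<lambda>r. H (r *\<^sub>R (s *\<^sub>R x))) has_real_derivative E (s *\<^sub>R x)) (at (s / s))"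
    using assms(1) unfolding euler_deriv_def by metis
  have 2: "((\<lambda>r. r / s) has_real_derivative 1 / s) (at s)"
    using assms(2) by (auto intro!: derivative_eq_intros)
  have "((\<lambda>r. H ((r / s) *\<^sub>R (s *\<^sub>R x))) has_real_derivative E (s *\<^sub>R x) * (1 / s)) (at s)"
    by (rule DERIV_chain2[OF 1 2])
  then show ?thesis using assms(2) by simp
qed

lemma lborel_integral_dilation:
  fixes F :: "'a::euclidean_space \<Rightarrow> real"
  assumes F: "integrable lborel F" and s: "s > 0"
  shows "integrable lborel (\<lambda>x. F (s *\<^sub>R x))"
    and "(LINT x|lborel. F (s *\<^sub>R x)) = (LINT x|lborel. F x) / s ^ DIM('a)"
proof -
  have [measurable]: "F \<in> borel_measurable borel"
    using borel_measurable_integrable[OF F] by simp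
  have eq: "(lborel :: 'a measure) = density (distr lborel borel (\<lambda>x. s *\<^sub>R x)) (\<lambda>_. ennreal (s ^ DIM('a)))"
    using lborel_affine[of s "0::'a"] s by simp
  from F show "integrable lborel (\<lambda>x. F (s *\<^sub>R x))"
    using s by (subst (asm) eq) (simp add: integrable_density integrable_distr_eq)
  have "(LINT x|lborel. F x) = s ^ DIM('a) * (LINT x|lborel. F (s *\<^sub>R x))"
    using s by (subst eq) (simp add: integral_density integral_distr)
  then show "(LINT x|lborel. F (s *\<^sub>R x)) = (LINT x|lborel. F x) / s ^ DIM('a)"
    using s by simp
qed

text \<open>
  Along each ray, \<open>s ^ (d - 1) * (d * H + E) (s *\<^sub>R x)\<close> is the derivative of \<open>s ^ d * H (s *\<^sub>R x)\<close>,
  whose integral over \<open>x\<close> does not depend on \<open>s\<close>. Integrating the derivative over \<open>x\<close> and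
  \<open>1 \<le> s \<le> 2\<close> therefore gives zero, while integrating over \<open>x\<close> first gives
  \<open>ln 2\<close> times the integral of \<open>d * H + E\<close>. By Fubini both agree. Integrating over \<open>s\<close>
  replaces a differentiation under the integral sign at \<open>s = 1\<close>.
\<close>
theorem dilation_identity:
  fixes H E :: "'a::euclidean_space \<Rightarrow> real"
  assumes H: "integrable lborel H" and E: "integrable lborel E" and D: "euler_deriv H E"
  shows "(LINT x|lborel. real DIM('a) * H x + E x) = 0"
proof -
  define G where "G = (\<lambda>x. real DIM('a) * H x + E x)"
  have G: "integrable lborel G" unfolding G_def using H E by simp
  have [measurable]: "G \<in> borel_measurable borel"
    using borel_measurable_integrable[OF G] by simp
  let ?n = "DIM('a)"
  let ?I = "{1..2::real}"
  define P where "P = (\<lambda>s (x::'a). indicator ?I s * (s ^ (?n - 1) * G (s *\<^sub>R x)))"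
  have pow: "s ^ (?n - 1) / s ^ ?n = 1 / s" if "s > 0" for s :: real
    using that DIM_positive[where 'a='a] by (cases ?n) auto
  have slice: "integrable lborel (P s)" "(LINT x|lborel. P s x) = indicator ?I s * ((LINT x|lborel. G x) / s)"
    "(LINT x|lborel. norm (P s x)) = indicator ?I s * ((LINT x|lborel. norm (G x)) / s)" for s
  proof -
    show "integrable lborel (P s)"
      by (cases "s \<in> ?I") (auto simp: P_def intro!: lborel_integral_dilation G)
    show "(LINT x|lborel. P s x) = indicator ?I s * ((LINT x|lborel. G x) / s)"
      using pow[of s] lborel_integral_dilation(2)[OF G, of s]
      by (cases "s \<in> ?I") (auto simp: P_def field_simps)
    have "integrable lborel (\<lambda>x. norm (G x))" using G by simp
    from lborel_integral_dilation(2)[OF this, of s]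
    show "(LINT x|lborel. norm (P s x)) = indicator ?I s * ((LINT x|lborel. norm (G x)) / s)"
      using pow[of s]
      by (cases "s \<in> ?I") (auto simp: P_def field_simps abs_mult)
  qed
  have cont: "continuous_on ?I (\<lambda>s. c / s)" for c :: real
    by (intro continuous_intros) auto
  have intp: "integrable (lborel \<Otimes>\<^sub>M lborel) (case_prod P)"
  proof (rule lborel_pair.Fubini_integrable)
    show "case_prod P \<in> borel_measurable (lborel \<Otimes>\<^sub>M lborel)"
      unfolding P_def by measurable
    show "integrable lborel (\<lambda>s. LINT x|lborel. norm (case (s, x) of (s, x) \<Rightarrow> P s x))"
      using borel_integrable_compact[OF compact_Icc cont[of "LINT x|lborel. norm (G x)"]]
      by (simp add: slice(3)[unfolded real_norm_def])
    show "AE s in lborel. integrable lborel (\<lambda>x. case (s, x) of (s, x) \<Rightarrow> P s x)"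
      using slice(1) by simp
  qed
  have der: "((\<lambda>r. r ^ ?n * H (r *\<^sub>R x)) has_real_derivative s ^ (?n - 1) * G (s *\<^sub>R x)) (at s)"
    if "s > 0" for s x
    using that DIM_positive[where 'a='a]
    by (auto intro!: derivative_eq_intros euler_derivD[OF D] simp: G_def field_simps
        simp flip: power_Suc)
  have inner: "(LINT s|lborel. P s x) = 2 ^ ?n * H (2 *\<^sub>R x) - H x"
    if "integrable lborel (\<lambda>s. P s x)" for x
  proof -
    let ?f = "\<lambda>s. s ^ (?n - 1) * G (s *\<^sub>R x)"
    have si: "set_integrable lborel ?I ?f"
      using that unfolding P_def set_integrable_def by simp
    have "(?f has_integral (2 ^ ?n * H (2 *\<^sub>R x) - 1 ^ ?n * H (1 *\<^sub>R x))) ?I"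
    proof (rule fundamental_theorem_of_calculus)
      fix s :: real assume "s \<in> ?I"
      then have "((\<lambda>r. r ^ ?n * H (r *\<^sub>R x)) has_real_derivative ?f s) (at s within ?I)"
        by (intro has_field_derivative_at_within[OF der]) auto
      then show "((\<lambda>r. r ^ ?n * H (r *\<^sub>R x)) has_vector_derivative ?f s) (at s within ?I)"
        by (simp add: has_real_derivative_iff_has_vector_derivative)
    qed simp
    moreover have "(LINT s:?I|lborel. ?f s) = integral ?I ?f"
      by (rule set_borel_integral_eq_integral(2)[OF si])
    ultimately show ?thesis
      by (simp add: P_def set_lebesgue_integral_def integral_unique)
  qed
  have "(LINT x|lborel. LINT s|lborel. P s x) = (LINT x|lborel. 2 ^ ?n * H (2 *\<^sub>R x) - H x)"
  proof (rule integral_cong_AE)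
    show "(\<lambda>x. LINT s|lborel. P s x) \<in> borel_measurable lborel"
      unfolding P_def by measurable
    show "(\<lambda>x. 2 ^ ?n * H (2 *\<^sub>R x) - H x) \<in> borel_measurable lborel"
      using borel_measurable_integrable[OF H] by measurable
    show "AE x in lborel. (LINT s|lborel. P s x) = 2 ^ ?n * H (2 *\<^sub>R x) - H x"
      using lborel_pair.AE_integrable_snd[OF intp] by eventually_elim (rule inner)
  qed
  also have "\<dots> = 2 ^ ?n * (LINT x|lborel. H (2 *\<^sub>R x)) - (LINT x|lborel. H x)"
    using lborel_integral_dilation(1)[OF H, of 2] H by simp
  also have "\<dots> = 0" using lborel_integral_dilation(2)[OF H, of 2] by simp
  finally have zero: "(LINT x|lborel. LINT s|lborel. P s x) = 0" .
  have "(LINT x|lborel. LINT s|lborel. P s x) = (LINT s|lborel. LINT x|lborel. P s x)"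
    by (rule lborel_pair.Fubini_integral[OF intp])
  also have "\<dots> = (LINT s:?I|lborel. 1 / s) * (LINT x|lborel. G x)"
    unfolding slice(2) set_lebesgue_integral_def
    by (subst integral_mult_left_zero[symmetric]) simp
  also have "(LINT s:?I|lborel. 1 / s) = ln 2"
  proof -
    have "((\<lambda>s. 1 / s) has_integral (ln 2 - ln 1)) ?I"
      by (rule fundamental_theorem_of_calculus)
         (auto simp flip: has_real_derivative_iff_has_vector_derivative
            intro!: derivative_eq_intros)
    moreover have "set_integrable lborel ?I (\<lambda>s. 1 / s)"
      unfolding set_integrable_def using borel_integrable_compact[OF compact_Icc cont[of 1]]
      by simp
    ultimately show ?thesis
      using set_borel_integral_eq_integral(2) by (metis diff_zero integral_unique ln_one)
  qed
  finally have "ln 2 * (LINT x|lborel. G x) = 0" using zero by simp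
  then show ?thesis unfolding G_def by simp
qed

section \<open>Differentiation under the integral and Gaussian densities\<close>
lemma has_real_derivative_integral:
  fixes F F' :: "real \<Rightarrow> 'b \<Rightarrow> real"
  assumes int: "\<And>s. integrable M (F s)"
    and der: "\<And>s z. z \<in> space M \<Longrightarrow> ((\<lambda>r. F r z) has_real_derivative F' s z) (at s)"
    and bnd: "\<And>s z. z \<in> space M \<Longrightarrow> \<bar>F' s z\<bar> \<le> B z"
    and B: "integrable M B" and F': "F' a \<in> borel_measurable M"
  shows "((\<lambda>s. LINT z|M. F s z) has_real_derivative (LINT z|M. F' a z)) (at a)"
  unfolding has_field_derivative_iff
proof (subst tendsto_at_iff_sequentially, intro allI impI)
  fix X :: "nat \<Rightarrow> real" assume X: "\<forall>i. X i \<in> UNIV - {a}" "X \<longlonglongrightarrow> a"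
  have "(\<lambda>i. LINT z|M. (F (X i) z - F a z) / (X i - a)) \<longlonglongrightarrow> (LINT z|M. F' a z)"
  proof (rule integral_dominated_convergence[OF F' _ B])
    show "(\<lambda>z. (F (X i) z - F a z) / (X i - a)) \<in> borel_measurable M" for i
      using int[THEN borel_measurable_integrable] by measurable
    have "(\<lambda>i. (F (X i) z - F a z) / (X i - a)) \<longlonglongrightarrow> F' a z" if "z \<in> space M" for z
    proof -
      have "((\<lambda>y. (F y z - F a z) / (y - a)) \<longlongrightarrow> F' a z) (at a)"
        using der[OF that, of a] unfolding has_field_derivative_iff .
      then show ?thesis
        unfolding tendsto_at_iff_sequentially comp_def using X by blast
    qed
    then show "AE z in M. (\<lambda>i. (F (X i) z - F a z) / (X i - a)) \<longlonglongrightarrow> F' a z"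
      by simp
    have "norm ((F (X i) z - F a z) / (X i - a)) \<le> B z" if "z \<in> space M" for i z
    proof -
      have "norm (F (X i) z - F a z) \<le> B z * norm (X i - a)"
        by (rule field_differentiable_bound[of UNIV]) (use der bnd that in auto)
      then show ?thesis using X(1) by (simp add: divide_le_eq)
    qed
    then show "AE z in M. norm ((F (X i) z - F a z) / (X i - a)) \<le> B z" for i
      by simp
  qed
  then show "((\<lambda>y. ((LINT z|M. F y z) - (LINT z|M. F a z)) / (y - a)) \<circ> X) \<longlonglongrightarrow> (LINT z|M. F' a z)"
    using int by (simp add: comp_def)
qed

abbreviation gauss_const :: "'n::finite itself \<Rightarrow> real" where
  "gauss_const _ \<equiv> (2 * pi) powr (- (real CARD('n) / 2))"

lemma gauss_density_pos: "gauss_density z > 0"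
  by (simp add: gauss_density_def)

lemma gauss_density_nonneg [simp]: "gauss_density z \<ge> 0"
  using gauss_density_pos by (rule less_imp_le)

lemma gauss_density_le: "gauss_density (z :: real ^ 'n) \<le> gauss_const TYPE('n)"
  by (simp add: gauss_density_def)

lemma gauss_density_measurable [measurable]: "gauss_density \<in> borel_measurable borel"
  unfolding gauss_density_def[abs_def] by measurable

text \<open>The Gaussian factorises over the coordinates into one-dimensional normal densities.\<close>
lemma integrable_gaussian_norm:
  fixes a :: real assumes a: "a > 0"
  shows "integrable lborel (\<lambda>x::'a::euclidean_space. exp (- (a * (norm x)\<^sup>2)))"
proof (rule integrableI_bounded)
  define \<sigma> where "\<sigma> = sqrt (1 / (2 * a))"
  have \<sigma>: "\<sigma> > 0" "2 * \<sigma>\<^sup>2 = 1 / a" using a by (auto simp: \<sigma>_def)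
  have eq: "exp (- (a * t\<^sup>2)) = sqrt (2 * pi * \<sigma>\<^sup>2) * normal_density 0 \<sigma> t" for t
    using \<sigma> a by (simp add: normal_density_def field_simps)
  have fin: "(\<integral>\<^sup>+t. ennreal (exp (- (a * t\<^sup>2))) \<partial>lborel) < \<infinity>"
  proof -
    have "integrable lborel (\<lambda>t. sqrt (2 * pi * \<sigma>\<^sup>2) * normal_density 0 \<sigma> t)"
      using \<sigma> by (intro integrable_mult_right integrable_normal_density)
    then have "integrable lborel (\<lambda>t. exp (- (a * t\<^sup>2)))" by (simp add: eq)
    then show ?thesis by (simp add: integrable_iff_bounded)
  qed
  have "(\<integral>\<^sup>+(x::'a). ennreal (norm (exp (- (a * (norm x)\<^sup>2)))) \<partial>lborel)
      = (\<integral>\<^sup>+(x::'a). ennreal (\<Prod>b\<in>Basis. exp (- (a * (x \<bullet> b)\<^sup>2))) \<partial>lborel)"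
  proof -
    have "(norm x)\<^sup>2 = (\<Sum>b\<in>Basis. (x \<bullet> b)\<^sup>2)" for x :: 'a
      unfolding power2_norm_eq_inner by (subst euclidean_inner) (simp add: power2_eq_square)
    then show ?thesis
      by (simp add: exp_sum[symmetric] sum_negf sum_distrib_left[symmetric])
  qed
  also have "\<dots> = (\<integral>\<^sup>+(x::'a). (\<Prod>b\<in>Basis. ennreal (exp (- (a * (x \<bullet> b)\<^sup>2)))) \<partial>lborel)"
    by (simp add: prod_ennreal)
  also have "\<dots> = (\<Prod>b\<in>(Basis::'a set). (\<integral>\<^sup>+t. ennreal (exp (- (a * t\<^sup>2))) \<partial>lborel))"
    by (subst nn_integral_lborel_prod) auto
  also have "\<dots> < \<infinity>"
    using fin by (simp add: power_less_top_ennreal)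
  finally show "(\<integral>\<^sup>+(x::'a). ennreal (norm (exp (- (a * (norm x)\<^sup>2)))) \<partial>lborel) < \<infinity>" .
qed simp

lemma gauss_density_integrable: "integrable lborel (gauss_density :: real ^ 'n \<Rightarrow> real)"
  unfolding gauss_density_def[abs_def]
  using integrable_gaussian_norm[of "1/2", where 'a="real ^ 'n"]
  by (intro integrable_mult_right) simp

lemma norm_diff_le_young:
  fixes x z :: "'a::real_inner" assumes "k > 0"
  shows "(norm (x - z))\<^sup>2 \<le> (1 + k) * (norm x)\<^sup>2 + (1 + 1 / k) * (norm z)\<^sup>2"
proof -
  have "0 \<le> (norm (k *\<^sub>R x + z))\<^sup>2 / k" using assms by simp
  also have "(norm (k *\<^sub>R x + z))\<^sup>2 / k = k * (norm x)\<^sup>2 + 2 * (x \<bullet> z) + (norm z)\<^sup>2 / k"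
    using assms by (simp add: power2_norm_eq_inner algebra_simps inner_commute) 
      (simp add: field_simps inner_commute)
  finally show ?thesis
    by (simp add: power2_norm_eq_inner algebra_simps inner_commute)
qed

section \<open>Mixtures with one subgaussian mixing distribution\<close>

text \<open>
  The subgaussian parameter is coupled to \<open>D\<close> in order that every constant below is a power of \<open>D\<close>.
\<close>
locale subgaussian_prior = prob_space \<pi> for \<pi> :: "(real ^ 'n) measure" +
  fixes D :: real
  assumes sets_eq [measurable_cong]: "sets \<pi> = sets borel" and D2: "2 \<le> D"
    and subg: "subgaussian (1 - 1 / D) \<pi>"
begin

definition K where "K = 1 - 1 / D"

lemma K_bounds: "K \<ge> 1 / 2" "K < 1" "1 - K = 1 / D" "K * D = D - 1"
  using D2 by (auto simp: K_def field_simps)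

lemma space_eq [simp]: "space \<pi> = UNIV"
  using sets_eq_imp_space_eq[OF sets_eq] by simp

lemma prob_UNIV [simp]: "prob UNIV = 1"
  using prob_space by simp

text \<open>
  By the layer-cake formula \<open>E exp (a |Z|\<^sup>2) - 1\<close> is the integral of
  \<open>2 a t exp (a t\<^sup>2) P(|Z| > t)\<close>, which the subgaussian tail bounds by \<open>a / (b - a)\<close> with
  \<open>b = 1 / (2 K\<^sup>2)\<close>. The exponent \<open>a = 1 / (2 K)\<close> lies strictly between \<open>1 / 2\<close> and \<open>b\<close>: it must exceed
  \<open>1 / 2\<close> to beat the Gaussian kernel in the posterior estimate, and this is where \<open>K < 1\<close> enters.
\<close>
lemma exp_moment:
  shows "integrable \<pi> (\<lambda>z. exp ((norm z)\<^sup>2 / (2 * K)))"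
    and "(LINT z|\<pi>. exp ((norm z)\<^sup>2 / (2 * K))) \<le> D"
proof -
  define a where "a = 1 / (2 * K)"
  define b where "b = 1 / (2 * K\<^sup>2)"
  have K0: "K > 0" using K_bounds by simp
  have ab: "a > 0" "b - a > 0" "a / (b - a) = D - 1"
  proof -
    show "a > 0" using K0 by (simp add: a_def)
    have e: "b - a = (1 - K) / (2 * K\<^sup>2)"
      using K0 by (simp add: a_def b_def field_simps power2_eq_square)
    show "b - a > 0" unfolding e using K0 K_bounds D2 by simp
    have "a / (b - a) = K * D"
      unfolding e K_bounds(3) using K0 D2 by (simp add: a_def field_simps power2_eq_square)
    then show "a / (b - a) = D - 1" using K_bounds(4) by simp
  qed
  define k where "k = (\<lambda>t::real. 2 * a * t * exp (a * t\<^sup>2))"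
  have k0: "k t \<ge> 0" if "t \<ge> 0" for t using that ab by (simp add: k_def)
  have layer: "ennreal (exp (a * r\<^sup>2) - 1) = (\<integral>\<^sup>+t. ennreal (k t) * indicator {0..} t * indicator {t<..} r \<partial>lborel)"
    if "r \<ge> 0" for r :: real
  proof -
    have "(\<integral>\<^sup>+t. ennreal (k t) * indicator {0..} t * indicator {t<..} r \<partial>lborel)
        = (\<integral>\<^sup>+t. ennreal (k t) * indicator {0..r} t \<partial>lborel)"
    proof (rule nn_integral_cong_AE)
      show "AE t in lborel. ennreal (k t) * indicator {0..} t * indicator {t<..} r
          = ennreal (k t) * indicator {0..r} t"
        using AE_lborel_singleton[of r] by eventually_elim (auto simp: indicator_def)
    qed
    also have "\<dots> = ennreal (exp (a * r\<^sup>2) - exp (a * 0\<^sup>2))"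
    proof (rule nn_integral_FTC_Icc)
      show "k \<in> borel_measurable borel" unfolding k_def by measurable
      show "((\<lambda>t. exp (a * t\<^sup>2)) has_real_derivative k t) (at t)" for t
        unfolding k_def by (auto intro!: derivative_eq_intros)
    qed (use k0 that in auto)
    finally show ?thesis by simp
  qed
  interpret P: pair_sigma_finite lborel \<pi> ..
  have "(\<integral>\<^sup>+z. ennreal (exp (a * (norm z)\<^sup>2) - 1) \<partial>\<pi>)
      = (\<integral>\<^sup>+z. \<integral>\<^sup>+t. ennreal (k t) * indicator {0..} t * indicator {t<..} (norm z) \<partial>lborel \<partial>\<pi>)"
    by (simp add: layer)
  also have "\<dots> = (\<integral>\<^sup>+t. \<integral>\<^sup>+z. ennreal (k t) * indicator {0..} t * indicator {t<..} (norm z) \<partial>\<pi> \<partial>lborel)"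
    unfolding k_def by (rule P.Fubini') (simp add: greaterThan_def)
  also have "\<dots> \<le> (\<integral>\<^sup>+t. ennreal (2 * a * t * exp (- ((b - a) * t\<^sup>2))) * indicator {0..} t \<partial>lborel)"
  proof (rule nn_integral_mono)
    fix t :: real
    show "(\<integral>\<^sup>+z. ennreal (k t) * indicator {0..} t * indicator {t<..} (norm z) \<partial>\<pi>)
        \<le> ennreal (2 * a * t * exp (- ((b - a) * t\<^sup>2))) * indicator {0..} t"
    proof (cases "t \<ge> 0")
      case True
      have "(\<integral>\<^sup>+z. ennreal (k t) * indicator {0..} t * indicator {t<..} (norm z) \<partial>\<pi>)
          = (\<integral>\<^sup>+z. ennreal (k t) * indicator {z. norm z > t} z \<partial>\<pi>)"
        using True by (intro nn_integral_cong) (auto simp: indicator_def)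
      also have "\<dots> = ennreal (k t) * emeasure \<pi> {z. norm z > t}"
        by (rule nn_integral_cmult_indicator) simp
      also have "\<dots> \<le> ennreal (k t) * ennreal (exp (- (b * t\<^sup>2)))"
        using subg True unfolding subgaussian_def K_def[symmetric] emeasure_eq_measure
        by (intro mult_left_mono ennreal_leI) (auto simp: b_def)
      also have "\<dots> = ennreal (2 * a * t * exp (- ((b - a) * t\<^sup>2)))"
        using k0[OF True]
        by (simp add: ennreal_mult[symmetric] k_def mult.assoc exp_add[symmetric] algebra_simps)
      finally show ?thesis using True by simp
    qed simp
  qed
  also have "\<dots> = ennreal (0 - (- (a / (b - a)) * exp (- ((b - a) * 0\<^sup>2))))"
  proof (rule nn_integral_FTC_atLeast)
    show "((\<lambda>t. - (a / (b - a)) * exp (- ((b - a) * t\<^sup>2))) has_real_derivative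
        2 * a * t * exp (- ((b - a) * t\<^sup>2))) (at t)" for t
    proof -
      have "((\<lambda>t. - c * exp (- (m * t\<^sup>2))) has_real_derivative 2 * (c * m) * t * exp (- (m * t\<^sup>2))) (at t)"
        for c m :: real
        by (auto intro!: derivative_eq_intros)
      moreover have "a / (b - a) * (b - a) = a" using ab(2) by simp
      ultimately show ?thesis by metis
    qed
    have "filterlim (\<lambda>t::real. (b - a) * t\<^sup>2) at_top at_top"
      using ab by (intro filterlim_tendsto_pos_mult_at_top[OF tendsto_const] filterlim_pow_at_top filterlim_ident) auto
    then have "((\<lambda>t::real. exp (- ((b - a) * t\<^sup>2))) \<longlongrightarrow> 0) at_top"
      by (intro filterlim_compose[OF exp_at_bot] filterlim_uminus_at_bot_at_top[THEN filterlim_compose])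
    from tendsto_mult_left[OF this, of "- (a / (b - a))"]
    show "((\<lambda>t. - (a / (b - a)) * exp (- ((b - a) * t\<^sup>2))) \<longlongrightarrow> 0) at_top" by simp
  qed (use ab in auto)
  also have "\<dots> = ennreal (D - 1)" using ab(3) by simp
  finally have bound: "(\<integral>\<^sup>+z. ennreal (exp (a * (norm z)\<^sup>2) - 1) \<partial>\<pi>) \<le> ennreal (D - 1)" .
  have i: "integrable \<pi> (\<lambda>z. exp (a * (norm z)\<^sup>2) - 1)"
    using ab(1) bound by (intro integrableI_bounded) (auto simp: less_le_trans top.not_eq_extremum le_less_trans)
  from Bochner_Integration.integrable_add[OF i integrable_const[of 1]]
  have i2: "integrable \<pi> (\<lambda>z. exp (a * (norm z)\<^sup>2))" by simp
  have eq: "exp (a * (norm z)\<^sup>2) = exp ((norm z)\<^sup>2 / (2 * K))" for z :: "real ^ 'n"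
    by (simp add: a_def)
  show "integrable \<pi> (\<lambda>z. exp ((norm z)\<^sup>2 / (2 * K)))" using i2 unfolding eq .
  have "(LINT z|\<pi>. exp (a * (norm z)\<^sup>2) - 1) \<le> D - 1"
    using bound nn_integral_eq_integral[OF i] ab(1) D2 by (simp add: ennreal_le_iff)
  then show "(LINT z|\<pi>. exp ((norm z)\<^sup>2 / (2 * K))) \<le> D"
    using i2 by (simp add: eq)
qed

lemma second_moment:
  shows "integrable \<pi> (\<lambda>z. (norm z)\<^sup>2)" and "(LINT z|\<pi>. (norm z)\<^sup>2) \<le> 2 * D"
proof -
  have K0: "K > 0" using K_bounds by simp
  have le: "(norm z)\<^sup>2 \<le> 2 * K * (exp ((norm z)\<^sup>2 / (2 * K)) - 1)" for z :: "real ^ 'n"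
  proof -
    have "(norm z)\<^sup>2 / (2 * K) \<le> exp ((norm z)\<^sup>2 / (2 * K)) - 1"
      using exp_ge_add_one_self[of "(norm z)\<^sup>2 / (2 * K)"] by linarith
    then show ?thesis using K0 by (simp add: field_simps)
  qed
  have i: "integrable \<pi> (\<lambda>z. 2 * K * (exp ((norm z)\<^sup>2 / (2 * K)) - 1))"
    using exp_moment(1) by simp
  show i2: "integrable \<pi> (\<lambda>z. (norm z)\<^sup>2)"
    by (rule Bochner_Integration.integrable_bound[OF i]) (use le in \<open>auto intro: order_trans[OF _ abs_ge_self]\<close>)
  have "(LINT z|\<pi>. (norm z)\<^sup>2) \<le> (LINT z|\<pi>. 2 * K * (exp ((norm z)\<^sup>2 / (2 * K)) - 1))"
    by (rule integral_mono[OF i2 i le])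
  also have "\<dots> = 2 * K * ((LINT z|\<pi>. exp ((norm z)\<^sup>2 / (2 * K))) - 1)"
    using exp_moment(1) by simp
  also have "\<dots> \<le> 2 * K * (D - 1)"
    using exp_moment(2) K0 by (intro mult_left_mono) auto
  also have "\<dots> \<le> 2 * 1 * D" using K_bounds K0 D2 by (intro mult_mono) auto
  finally show "(LINT z|\<pi>. (norm z)\<^sup>2) \<le> 2 * D" by simp
qed

abbreviation f :: "real ^ 'n \<Rightarrow> real" where "f \<equiv> gauss_mixture \<pi>"

lemma integrable_gauss_mult:
  assumes "integrable \<pi> u"
  shows "integrable \<pi> (\<lambda>z. u z * gauss_density (x - z))"
proof (rule Bochner_Integration.integrable_bound[of _ "\<lambda>z. gauss_const TYPE('n) * u z"])
  show "integrable \<pi> (\<lambda>z. gauss_const TYPE('n) * u z)" using assms by simp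
  show "(\<lambda>z. u z * gauss_density (x - z)) \<in> borel_measurable \<pi>"
    using borel_measurable_integrable[OF assms] by measurable
  show "AE z in \<pi>. norm (u z * gauss_density (x - z)) \<le> norm (gauss_const TYPE('n) * u z)"
    using gauss_density_le[of "x - _"] gauss_density_pos[of "x - _"]
    by (intro AE_I2) (auto simp: abs_mult mult.commute less_imp_le intro!: mult_mono)
qed

lemma integrable_gauss: "integrable \<pi> (\<lambda>z. gauss_density (x - z))"
  using integrable_gauss_mult[of "\<lambda>_. 1"] by simp

lemma mixture_measurable [measurable]: "f \<in> borel_measurable borel"
  unfolding gauss_mixture_def[abs_def] by measurable

lemma mixture_le: "f x \<le> gauss_const TYPE('n)"
proof -
  have "f x \<le> (LINT z|\<pi>. gauss_const TYPE('n))"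
    unfolding gauss_mixture_def using integrable_gauss gauss_density_le by (intro integral_mono) auto
  then show ?thesis by simp
qed

text \<open>
  By Young's inequality with parameter \<open>1 / (2 D)\<close> the kernel at \<open>x - z\<close> is at least a Gaussian in
  \<open>x\<close> that is only slightly narrower than the standard one, times \<open>exp (- B |z|\<^sup>2 / 2)\<close> with
  \<open>B = 1 + 2 D\<close>. Averaging the latter is Jensen's inequality for the exponential, carried out with
  the tangent line at the exponent \<open>- B D\<close>, where \<open>D\<close> bounds half the second moment.
\<close>
lemma mixture_ge: "f x \<ge> gauss_const TYPE('n) * exp (- ((1 + 1 / (2 * D)) * (norm x)\<^sup>2 / 2 + (1 + 2 * D) * D))"
proof -
  define A where "A = (1 + 1 / (2 * D)) * (norm x)\<^sup>2 / 2"
  define B where "B = 1 + 2 * D"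
  have B0: "B \<ge> 0" using D2 by (simp add: B_def)
  define C where "C = gauss_const TYPE('n) * exp (- (A + B * D))"
  have tangent: "C * (1 + B * D - B / 2 * (norm z)\<^sup>2) \<le> gauss_density (x - z)" for z
  proof -
    have "(norm (x - z))\<^sup>2 / 2 \<le> A + B / 2 * (norm z)\<^sup>2"
      using norm_diff_le_young[of "1 / (2 * D)" x z] D2 by (simp add: A_def B_def field_simps)
    then have "exp (- (A + B / 2 * (norm z)\<^sup>2)) \<le> exp (- ((norm (x - z))\<^sup>2 / 2))"
      by simp
    moreover have "exp (- (A + B * D)) * (1 + (B * D - B / 2 * (norm z)\<^sup>2)) \<le>
        exp (- (A + B * D)) * exp (B * D - B / 2 * (norm z)\<^sup>2)"
      by (intro mult_left_mono exp_ge_add_one_self) simp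
    moreover have "\<dots> = exp (- (A + B / 2 * (norm z)\<^sup>2))"
      by (simp add: exp_add[symmetric])
    ultimately have "exp (- (A + B * D)) * (1 + (B * D - B / 2 * (norm z)\<^sup>2)) \<le> exp (- ((norm (x - z))\<^sup>2 / 2))"
      by linarith
    then show ?thesis
      by (simp add: C_def gauss_density_def mult.assoc add_diff_eq)
  qed
  have C0: "C \<ge> 0" by (simp add: C_def)
  have "C * (1 + B * D - B / 2 * (2 * D)) \<le> C * (1 + B * D - B / 2 * (LINT z|\<pi>. (norm z)\<^sup>2))"
    using second_moment(2) B0 C0 by (intro mult_left_mono diff_left_mono) auto
  also have "\<dots> = (LINT z|\<pi>. C * (1 + B * D - B / 2 * (norm z)\<^sup>2))"
    using second_moment(1) by simp
  also have "\<dots> \<le> f x"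
    unfolding gauss_mixture_def using second_moment(1) integrable_gauss tangent
    by (intro integral_mono) auto
  finally show ?thesis by (simp add: C_def A_def B_def)
qed

lemma mixture_pos: "f x > 0"
  by (rule less_le_trans[OF _ mixture_ge]) simp

text \<open>
  A crude tail bound that serves integrability only: since \<open>|x|\<^sup>2 \<le> 2 |x - z|\<^sup>2 + 2 |z|\<^sup>2\<close>, half of the
  exponent is kept and the rest is absorbed by the exponential moment.
\<close>
lemma mixture_decay: "f x \<le> gauss_const TYPE('n) * D * exp (- ((norm x)\<^sup>2 / 4))"
proof -
  let ?C = "gauss_const TYPE('n) * exp (- ((norm x)\<^sup>2 / 4))"
  have le: "gauss_density (x - z) \<le> ?C * exp ((norm z)\<^sup>2 / (2 * K))" for z
  proof -
    have "(norm x)\<^sup>2 \<le> 2 * (norm (x - z))\<^sup>2 + 2 * (norm z)\<^sup>2"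
      using norm_diff_le_young[of 1 "x - z" "- z"] by simp
    moreover have "(norm z)\<^sup>2 / 2 \<le> (norm z)\<^sup>2 / (2 * K)"
      using K_bounds by (intro divide_left_mono) auto
    ultimately have "- ((norm (x - z))\<^sup>2 / 2) \<le> - ((norm x)\<^sup>2 / 4) + (norm z)\<^sup>2 / (2 * K)"
      by (simp add: field_simps)
    then have "exp (- ((norm (x - z))\<^sup>2 / 2)) \<le> exp (- ((norm x)\<^sup>2 / 4)) * exp ((norm z)\<^sup>2 / (2 * K))"
      by (simp add: exp_add[symmetric])
    then show ?thesis by (simp add: gauss_density_def mult.assoc)
  qed
  have "f x \<le> (LINT z|\<pi>. ?C * exp ((norm z)\<^sup>2 / (2 * K)))"
    unfolding gauss_mixture_def using exp_moment(1) integrable_gauss le by (intro integral_mono) auto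
  also have "\<dots> = ?C * (LINT z|\<pi>. exp ((norm z)\<^sup>2 / (2 * K)))" by simp
  also have "\<dots> \<le> ?C * D" using exp_moment(2) by (intro mult_left_mono) auto
  finally show ?thesis by (simp add: mult_ac)
qed

text \<open>
  Divided by \<open>f x\<close>, this says that the posterior second moment \<open>E[|Z|\<^sup>2 | x]\<close> is smaller than \<open>|x|\<^sup>2\<close>
  by a definite factor, up to a constant. By Jensen's inequality \<open>E[|Z|\<^sup>2 | x] / (2 K)\<close> is at most the
  logarithm of \<open>E[exp (|Z|\<^sup>2 / (2 K)) | x]\<close>; there the numerator is bounded by the prior exponential
  moment and the denominator \<open>f x\<close> from below by \<open>mixture_ge\<close>. This gives
  \<open>K (1 + 1 / (2 D)) |x|\<^sup>2\<close> plus a constant, and the coefficient is below \<open>1 - 1 / (2 D)\<close>.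
\<close>
lemma posterior_second_moment:
  "(LINT z|\<pi>. (norm z)\<^sup>2 * gauss_density (x - z)) \<le> ((1 - 1 / (2 * D)) * (norm x)\<^sup>2 + 4 * D\<^sup>2) * f x"
proof -
  have K0: "K > 0" using K_bounds by simp
  \<comment> \<open>\<open>l\<close> bounds the logarithm of the posterior exponential moment; the factor
      \<open>D\<close> from the moment is enlarged to \<open>exp D\<close>. The step \<open>u \<le> l - 1 + exp (u - l)\<close> replaces Jensen.\<close>
  define l where "l = D + ((1 + 1 / (2 * D)) * (norm x)\<^sup>2 / 2 + (1 + 2 * D) * D)"
  have le: "(norm z)\<^sup>2 / (2 * K) * gauss_density (x - z)
      \<le> (l - 1) * gauss_density (x - z) + exp (- l) * gauss_const TYPE('n) * exp ((norm z)\<^sup>2 / (2 * K))" for z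
  proof -
    have "(norm z)\<^sup>2 / (2 * K) \<le> (l - 1) + exp ((norm z)\<^sup>2 / (2 * K) - l)"
      using exp_ge_add_one_self[of "(norm z)\<^sup>2 / (2 * K) - l"] by linarith
    then have "(norm z)\<^sup>2 / (2 * K) * gauss_density (x - z)
        \<le> ((l - 1) + exp ((norm z)\<^sup>2 / (2 * K) - l)) * gauss_density (x - z)"
      using gauss_density_pos[of "x - z"] by (intro mult_right_mono) auto
    also have "\<dots> \<le> (l - 1) * gauss_density (x - z) + exp ((norm z)\<^sup>2 / (2 * K) - l) * gauss_const TYPE('n)"
      using gauss_density_le[of "x - z"] by (simp add: distrib_right)
    also have "exp ((norm z)\<^sup>2 / (2 * K) - l) = exp (- l) * exp ((norm z)\<^sup>2 / (2 * K))"
      by (simp add: exp_add[symmetric])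
    finally show ?thesis by (simp add: mult_ac)
  qed
  have q: "integrable \<pi> (\<lambda>z. (norm z)\<^sup>2 / (2 * K) * gauss_density (x - z))"
    using integrable_gauss_mult second_moment(1) by simp
  have "(LINT z|\<pi>. (norm z)\<^sup>2 * gauss_density (x - z)) / (2 * K)
      = (LINT z|\<pi>. (norm z)\<^sup>2 / (2 * K) * gauss_density (x - z))" by simp
  also have "\<dots> \<le> (LINT z|\<pi>. (l - 1) * gauss_density (x - z) + exp (- l) * gauss_const TYPE('n) * exp ((norm z)\<^sup>2 / (2 * K)))"
    using q integrable_gauss exp_moment(1) le by (intro integral_mono) auto
  also have "\<dots> = (l - 1) * f x + exp (- l) * gauss_const TYPE('n) * (LINT z|\<pi>. exp ((norm z)\<^sup>2 / (2 * K)))"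
    unfolding gauss_mixture_def using integrable_gauss exp_moment(1) by simp
  also have "exp (- l) * gauss_const TYPE('n) * (LINT z|\<pi>. exp ((norm z)\<^sup>2 / (2 * K))) \<le> exp (- l) * gauss_const TYPE('n) * exp D"
    using exp_moment(2) order_trans[OF less_imp_le[OF less_add_one] exp_ge_add_one_self[of D, unfolded add.commute[of 1]]] by (intro mult_left_mono) auto
  also have "\<dots> = gauss_const TYPE('n) * exp (- ((1 + 1 / (2 * D)) * (norm x)\<^sup>2 / 2 + (1 + 2 * D) * D))"
    by (simp add: l_def exp_add[symmetric])
  also have "\<dots> \<le> f x" by (rule mixture_ge)
  finally have "(LINT z|\<pi>. (norm z)\<^sup>2 * gauss_density (x - z)) / (2 * K) \<le> l * f x"
    by (simp add: algebra_simps)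
  then have "(LINT z|\<pi>. (norm z)\<^sup>2 * gauss_density (x - z)) \<le> (2 * K * l) * f x"
    using K0 by (simp add: field_simps)
  also have "\<dots> \<le> ((1 - 1 / (2 * D)) * (norm x)\<^sup>2 + 4 * D\<^sup>2) * f x"
  proof (rule mult_right_mono)
    have "2 * K * l = K * (1 + 1 / (2 * D)) * (norm x)\<^sup>2 + 4 * (K * D) * (1 + D)"
      by (simp add: l_def algebra_simps)
    also have "4 * (K * D) * (1 + D) \<le> 4 * D\<^sup>2"
      unfolding K_bounds(4) by (simp add: algebra_simps power2_eq_square)
    also have "K * (1 + 1 / (2 * D)) \<le> 1 - 1 / (2 * D)"
      using D2 by (simp add: K_def field_simps)
    then have "K * (1 + 1 / (2 * D)) * (norm x)\<^sup>2 \<le> (1 - 1 / (2 * D)) * (norm x)\<^sup>2"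
      by (rule mult_right_mono) simp
    finally show "2 * K * l \<le> (1 - 1 / (2 * D)) * (norm x)\<^sup>2 + 4 * D\<^sup>2" by simp
  qed (use mixture_pos in \<open>simp add: less_imp_le\<close>)
  finally show ?thesis .
qed

text \<open>The radial component \<open>x \<bullet> E[Z | x]\<close> of the posterior mean.\<close>
definition posterior_inner :: "real ^ 'n \<Rightarrow> real" where
  "posterior_inner x = (LINT z|\<pi>. (x \<bullet> z) * gauss_density (x - z)) / f x"

lemma posterior_inner_measurable [measurable]: "posterior_inner \<in> borel_measurable borel"
  unfolding posterior_inner_def[abs_def] by measurable

lemma integrable_inner: "integrable \<pi> (\<lambda>z. x \<bullet> z)"
proof -
  have "integrable \<pi> (\<lambda>z. norm x * (1 + (norm z)\<^sup>2))"
    using second_moment(1) by simp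
  then show ?thesis
  proof (rule Bochner_Integration.integrable_bound)
    have "\<bar>x \<bullet> z\<bar> \<le> norm x * (1 + (norm z)\<^sup>2)" for z
    proof -
      have "norm z \<le> 1 + (norm z)\<^sup>2" using sum_squares_bound[of 1 "norm z"] norm_ge_zero[of z]
        unfolding one_power2 by linarith
      then have "norm x * norm z \<le> norm x * (1 + (norm z)\<^sup>2)" by (rule mult_left_mono) simp
      then show ?thesis using Cauchy_Schwarz_ineq2[of x z] by linarith
    qed
    then show "AE z in \<pi>. norm (x \<bullet> z) \<le> norm (norm x * (1 + (norm z)\<^sup>2))"
      by (auto intro: order_trans[OF _ abs_ge_self])
  qed measurable
qed

text \<open>By \<open>x \<bullet> z \<le> (|x|\<^sup>2 + |z|\<^sup>2) / 2\<close> half of the gain in the posterior second moment survives.\<close>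
lemma posterior_inner_bound:
  "\<bar>posterior_inner x\<bar> \<le> (1 - 1 / (4 * D)) * (norm x)\<^sup>2 + 2 * D\<^sup>2"
proof -
  have le: "\<bar>(x \<bullet> z) * gauss_density (x - z)\<bar> \<le>
      (norm x)\<^sup>2 / 2 * gauss_density (x - z) + ((norm z)\<^sup>2 * gauss_density (x - z)) / 2" for z
  proof -
    have "\<bar>x \<bullet> z\<bar> \<le> (norm x)\<^sup>2 / 2 + (norm z)\<^sup>2 / 2"
      using Cauchy_Schwarz_ineq2[of x z] sum_squares_bound[of "norm x" "norm z"] by simp
    then have "\<bar>x \<bullet> z\<bar> * gauss_density (x - z) \<le> ((norm x)\<^sup>2 / 2 + (norm z)\<^sup>2 / 2) * gauss_density (x - z)"
      using gauss_density_pos[of "x - z"] by (intro mult_right_mono) auto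
    then show ?thesis using gauss_density_pos[of "x - z"] by (simp add: abs_mult algebra_simps)
  qed
  have "\<bar>LINT z|\<pi>. (x \<bullet> z) * gauss_density (x - z)\<bar> \<le> (LINT z|\<pi>. \<bar>(x \<bullet> z) * gauss_density (x - z)\<bar>)"
    by (rule integral_abs_bound)
  also have "\<dots> \<le> (LINT z|\<pi>. (norm x)\<^sup>2 / 2 * gauss_density (x - z) + ((norm z)\<^sup>2 * gauss_density (x - z)) / 2)"
    using integrable_gauss_mult[OF integrable_inner] integrable_gauss
      integrable_gauss_mult[OF second_moment(1)] le
    by (intro integral_mono) auto
  also have "\<dots> = (norm x)\<^sup>2 / 2 * f x + (LINT z|\<pi>. (norm z)\<^sup>2 * gauss_density (x - z)) / 2"
    unfolding gauss_mixture_def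
    using integrable_gauss integrable_gauss_mult[OF second_moment(1)] by simp
  also have "\<dots> \<le> ((1 - 1 / (4 * D)) * (norm x)\<^sup>2 + 2 * D\<^sup>2) * f x"
    using posterior_second_moment[of x] by (simp add: algebra_simps)
  finally show ?thesis
    using mixture_pos[of x] by (simp add: posterior_inner_def abs_div divide_le_eq)
qed

text \<open>Tweedie's formula, restricted to the radial direction.\<close>
lemma euler_mixture: "euler_deriv f (\<lambda>x. f x * (posterior_inner x - (norm x)\<^sup>2))"
  unfolding euler_deriv_def
proof
  fix x :: "real ^ 'n"
  let ?F' = "\<lambda>s z. - (x \<bullet> (s *\<^sub>R x - z)) * gauss_density (s *\<^sub>R x - z)"
  have "((\<lambda>s. LINT z|\<pi>. gauss_density (s *\<^sub>R x - z)) has_real_derivative (LINT z|\<pi>. ?F' 1 z)) (at 1)"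
  proof (rule has_real_derivative_integral[where B = "\<lambda>_. norm x * gauss_const TYPE('n)"])
    show "integrable \<pi> (\<lambda>z. gauss_density (s *\<^sub>R x - z))" for s by (rule integrable_gauss)
    show "((\<lambda>s. gauss_density (s *\<^sub>R x - z)) has_real_derivative ?F' s z) (at s)" for s z
      unfolding gauss_density_def power2_norm_eq_inner
      by (auto intro!: derivative_eq_intros simp: inner_commute algebra_simps add_divide_distrib diff_divide_distrib)
    show "\<bar>?F' s z\<bar> \<le> norm x * gauss_const TYPE('n)" for s z
    proof -
      define v where "v = s *\<^sub>R x - z"
      \<comment> \<open>The function \<open>r * exp (- r\<^sup>2 / 2)\<close> is bounded by 1, which gives a dominating
          constant that is uniform in \<open>s\<close> and \<open>z\<close>.\<close>
      have "norm v \<le> 1 + (norm v)\<^sup>2 / 2" using sum_squares_bound[of 1 "norm v"] by simp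
      also have "\<dots> \<le> exp ((norm v)\<^sup>2 / 2)" by (rule exp_ge_add_one_self)
      finally have "norm v * exp (- ((norm v)\<^sup>2 / 2)) \<le> 1"
        by (simp add: exp_minus field_simps)
      then have v: "norm x * gauss_const TYPE('n) * (norm v * exp (- ((norm v)\<^sup>2 / 2))) \<le> norm x * gauss_const TYPE('n) * 1"
        by (intro mult_left_mono) auto
      have "\<bar>?F' s z\<bar> = \<bar>x \<bullet> v\<bar> * gauss_density v"
        using gauss_density_pos[of v] by (simp add: v_def abs_mult)
      also have "\<dots> \<le> (norm x * norm v) * gauss_density v"
        using gauss_density_pos[of v] by (intro mult_right_mono Cauchy_Schwarz_ineq2) simp
      also have "\<dots> = norm x * gauss_const TYPE('n) * (norm v * exp (- ((norm v)\<^sup>2 / 2)))"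
        by (simp add: gauss_density_def)
      finally show ?thesis using v by simp
    qed
  qed simp_all
  also have "(LINT z|\<pi>. ?F' 1 z) = (LINT z|\<pi>. (x \<bullet> z) * gauss_density (x - z) - (norm x)\<^sup>2 * gauss_density (x - z))"
    by (simp add: inner_diff_right power2_norm_eq_inner algebra_simps)
  also have "\<dots> = f x * (posterior_inner x - (norm x)\<^sup>2)"
    using integrable_gauss_mult[OF integrable_inner] integrable_gauss mixture_pos[of x]
    by (simp add: posterior_inner_def gauss_mixture_def[symmetric] algebra_simps)
  finally show "((\<lambda>s. f (s *\<^sub>R x)) has_real_derivative f x * (posterior_inner x - (norm x)\<^sup>2)) (at 1)"
    unfolding gauss_mixture_def .
qed

lemma integrable_mixture_weighted: "integrable lborel (\<lambda>x. (1 + (norm x)\<^sup>2) * f x)"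
proof -
  have "integrable lborel (\<lambda>x::real ^ 'n. (8 * (gauss_const TYPE('n) * D)) * exp (- (1 / 8 * (norm x)\<^sup>2)))"
    by (intro integrable_mult_right integrable_gaussian_norm) simp
  then show ?thesis
  proof (rule Bochner_Integration.integrable_bound)
    have "(1 + (norm x)\<^sup>2) * f x \<le> (8 * (gauss_const TYPE('n) * D)) * exp (- (1 / 8 * (norm x)\<^sup>2))" for x
    proof -
      have "1 + (norm x)\<^sup>2 \<le> 8 * exp ((norm x)\<^sup>2 / 8)"
        using exp_ge_add_one_self[of "(norm x)\<^sup>2 / 8"] by linarith
      then have "(1 + (norm x)\<^sup>2) * f x \<le> (8 * exp ((norm x)\<^sup>2 / 8)) * (gauss_const TYPE('n) * D * exp (- ((norm x)\<^sup>2 / 4)))"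
        using mixture_decay[of x] mixture_pos[of x] by (intro mult_mono) auto
      also have "\<dots> = (8 * (gauss_const TYPE('n) * D)) * (exp ((norm x)\<^sup>2 / 8) * exp (- ((norm x)\<^sup>2 / 4)))"
        by (simp add: mult_ac)
      also have "exp ((norm x)\<^sup>2 / 8) * exp (- ((norm x)\<^sup>2 / 4)) = exp (- (1 / 8 * (norm x)\<^sup>2))"
        by (simp add: exp_add[symmetric])
      finally show ?thesis .
    qed
    then show "AE x in lborel. norm ((1 + (norm x)\<^sup>2) * f x) \<le> norm ((8 * (gauss_const TYPE('n) * D)) * exp (- (1 / 8 * (norm x)\<^sup>2)))"
      using mixture_pos D2 by (intro AE_I2) (simp add: abs_mult less_imp_le)
  qed measurable
qed

lemma integrable_mixture: "integrable lborel f"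
proof (rule Bochner_Integration.integrable_bound[OF integrable_mixture_weighted])
  have "norm (f x) \<le> norm ((1 + (norm x)\<^sup>2) * f x)" for x
    using mixture_pos[of x] by (simp add: abs_mult)
  then show "AE x in lborel. norm (f x) \<le> norm ((1 + (norm x)\<^sup>2) * f x)" by simp
qed measurable

text \<open>
  The common value for all mixing distributions is what matters: it allows the integral of \<open>f - g\<close>
  to be dropped from the divergence.
\<close>
lemma integral_mixture: "(LINT x|lborel. f x) = (LINT x|lborel. gauss_density (x :: real ^ 'n))"
proof -
  have shift: "(\<integral>\<^sup>+x. ennreal (gauss_density (x - z)) \<partial>lborel) = (\<integral>\<^sup>+x. ennreal (gauss_density (x :: real ^ 'n)) \<partial>lborel)" for z :: "real ^ 'n"
  proof -
    have "(\<integral>\<^sup>+x. ennreal (gauss_density (x - z)) \<partial>lborel)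
        = (\<integral>\<^sup>+x. ennreal (gauss_density x) \<partial>distr lborel borel ((+) (- z)))"
      by (simp add: nn_integral_distr)
    then show ?thesis by (simp only: lborel_distr_plus)
  qed
  interpret P: pair_sigma_finite \<pi> lborel ..
  have "(\<integral>\<^sup>+x. ennreal (f x) \<partial>lborel) = (\<integral>\<^sup>+x. \<integral>\<^sup>+z. ennreal (gauss_density (x - z)) \<partial>\<pi> \<partial>lborel)"
    unfolding gauss_mixture_def using integrable_gauss gauss_density_pos
    by (intro nn_integral_cong nn_integral_eq_integral[symmetric]) (auto simp: less_imp_le)
  also have "\<dots> = (\<integral>\<^sup>+z. \<integral>\<^sup>+x. ennreal (gauss_density (x - z)) \<partial>lborel \<partial>\<pi>)"
    by (rule P.Fubini') simp
  also have "\<dots> = (\<integral>\<^sup>+x. ennreal (gauss_density (x :: real ^ 'n)) \<partial>lborel)"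
    by (simp add: shift emeasure_space_1[simplified])
  also have "(\<integral>\<^sup>+x. ennreal (f x) \<partial>lborel) = ennreal (LINT x|lborel. f x)"
    using mixture_pos by (intro nn_integral_eq_integral integrable_mixture AE_I2) (simp add: less_imp_le)
  also have "(\<integral>\<^sup>+x. ennreal (gauss_density (x :: real ^ 'n)) \<partial>lborel) = ennreal (LINT x|lborel. gauss_density (x :: real ^ 'n))"
    by (intro nn_integral_eq_integral gauss_density_integrable AE_I2) simp
  finally show ?thesis
    by (subst (asm) ennreal_inj) (use mixture_pos in \<open>auto intro!: Bochner_Integration.integral_nonneg simp: less_imp_le\<close>)
qed

end

section \<open>Scalar inequalities for the log-likelihood ratio\<close>
lemma one_plus_mult_exp_le: "(1 + s) * exp (- s) \<le> (1::real)"
proof -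
  have "(1 + s) * exp (- s) \<le> exp s * exp (- s)"
    by (intro mult_right_mono exp_ge_add_one_self) simp
  then show ?thesis by (simp add: exp_add[symmetric])
qed

text \<open>
  With \<open>L = ln (f / g)\<close> and after multiplication by \<open>f\<close>, the left side is the integrand
  \<open>f L - f + g\<close> and the squared factor is the Hellinger integrand. Both vanish to second order at
  \<open>L = 0\<close>; the factor \<open>3 + max 0 L\<close> accounts for the linear growth as \<open>L\<close> tends to infinity.
\<close>
lemma kl_le_hellinger_weighted:
  fixes L :: real
  shows "L - 1 + exp (- L) \<le> (3 + max 0 L) * (1 - exp (- (L / 2)))\<^sup>2"
proof -
  define s where "s = L / 2"
  define t where "t = exp (- s)"
  have L: "L = 2 * s" by (simp add: s_def)
  have t2: "exp (- L) = t\<^sup>2" by (simp add: t_def L power2_eq_square exp_add[symmetric])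
  have "2 * s - 1 + t\<^sup>2 \<le> (3 + max 0 (2 * s)) * (1 - t)\<^sup>2"
  proof (cases "s \<ge> 0")
    case True
    have st: "(1 + s) * t \<le> 1" unfolding t_def by (rule one_plus_mult_exp_le)
    have t1: "t \<le> 1" using True by (simp add: t_def)
    have "s * (1 - t) \<le> ((1 + s) * (1 - t)) * (1 - t)"
      using st t1 by (intro mult_right_mono) (auto simp: algebra_simps)
    moreover have "s - (1 - t) \<le> s * (1 - t)" using st by (simp add: algebra_simps)
    ultimately have "s - (1 - t) \<le> (1 + s) * (1 - t)\<^sup>2" by (simp add: power2_eq_square mult.assoc)
    then have "(1 - t)\<^sup>2 + 2 * (s - (1 - t)) \<le> (1 - t)\<^sup>2 + 2 * ((1 + s) * (1 - t)\<^sup>2)" by simp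
    moreover have "(1 - t)\<^sup>2 + 2 * (s - (1 - t)) = 2 * s - 1 + t\<^sup>2"
      by (simp add: power2_eq_square algebra_simps)
    ultimately show ?thesis using True by (simp add: algebra_simps)
  next
    case False
    have t1: "t \<ge> 1" using False by (simp add: t_def)
    have "1 + s \<le> 1 / t" unfolding t_def using exp_ge_add_one_self[of s] by (simp add: exp_minus inverse_eq_divide)
    moreover have "0 \<le> 2 * (t - 1) ^ 3 / t" using t1 by simp
    moreover have "2 * (t - 1) ^ 3 / t = 2 * t\<^sup>2 - 6 * t + 6 - 2 * (1 / t)"
      using t1 by (simp add: field_simps power2_eq_square power3_eq_cube)
    ultimately have "2 * s \<le> 2 * t\<^sup>2 - 6 * t + 4" by linarith
    then show ?thesis using False by (simp add: power2_eq_square algebra_simps)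
  qed
  then show ?thesis unfolding t2 by (simp add: L t_def)
qed

text \<open>
  Truncation to \<open>L > 0\<close> keeps the potential nonnegative and restricts it to the region where the
  divergence can be large. The second factor vanishes doubly at 0, so the truncated function is
  still differentiable, and its derivative is comparable to the Hellinger integrand.
\<close>
definition psi :: "real \<Rightarrow> real" where
  "psi L = max 0 L * (1 - exp (- (L / 2)))\<^sup>2"

definition psi' :: "real \<Rightarrow> real" where
  "psi' L = (if L \<le> 0 then 0 else
     (1 - exp (- (L / 2)))\<^sup>2 + L * exp (- (L / 2)) * (1 - exp (- (L / 2))))"

lemma psi_measurable [measurable]: "psi \<in> borel_measurable borel" "psi' \<in> borel_measurable borel"
  unfolding psi_def[abs_def] psi'_def[abs_def] by measurable

lemma psi_deriv: "(psi has_real_derivative psi' L) (at L)"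
proof (cases L "0::real" rule: linorder_cases)
  case less
  have "((\<lambda>_. 0) has_real_derivative 0) (at L)" by simp
  then have "(psi has_real_derivative 0) (at L)"
    by (rule has_field_derivative_transform_within_open[of _ _ _ "{..<0}"])
       (use less in \<open>auto simp: psi_def\<close>)
  then show ?thesis using less by (simp add: psi'_def)
next
  case greater
  have "((\<lambda>L. L * (1 - exp (- (L / 2)))\<^sup>2) has_real_derivative psi' L) (at L)"
    using greater by (auto intro!: derivative_eq_intros simp: psi'_def algebra_simps power2_eq_square)
  then show ?thesis
    by (rule has_field_derivative_transform_within_open[of _ _ _ "{0<..}"])
       (use greater in \<open>auto simp: psi_def\<close>)
next
  case equal
  have "((\<lambda>y. (psi y - psi 0) / (y - 0)) \<longlongrightarrow> 0) (at 0)"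
  proof (rule Lim_null_comparison)
    have "norm ((psi y - psi 0) / (y - 0)) \<le> (1 - exp (- (y / 2)))\<^sup>2" if "y \<noteq> 0" for y
      using that by (auto simp: psi_def max_def abs_mult)
    then show "\<forall>\<^sub>F y in at 0. norm ((psi y - psi 0) / (y - 0)) \<le> (1 - exp (- (y / 2)))\<^sup>2"
      by (auto simp: eventually_at_filter)
    have "((\<lambda>y::real. (1 - exp (- (y / 2)))\<^sup>2) \<longlongrightarrow> (1 - exp (- (0 / 2)))\<^sup>2) (at 0)"
      by (intro tendsto_intros) auto
    then show "((\<lambda>y::real. (1 - exp (- (y / 2)))\<^sup>2) \<longlongrightarrow> 0) (at 0)" by simp
  qed
  then show ?thesis unfolding equal has_field_derivative_iff by (simp add: psi'_def)
qed

text \<open>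
  The inequality \<open>(1 + s) exp (- s) \<le> 1\<close> turns the factor \<open>L exp (- L / 2)\<close> in the second summand of
  the derivative into another factor \<open>1 - exp (- L / 2)\<close>.
\<close>
lemma psi'_bounds: "0 \<le> psi' L" "psi' L \<le> 3 * (1 - exp (- (L / 2)))\<^sup>2"
proof -
  show "0 \<le> psi' L" by (simp add: psi'_def)
  show "psi' L \<le> 3 * (1 - exp (- (L / 2)))\<^sup>2"
  proof (cases "L \<le> 0")
    case False
    have "(1 + L / 2) * exp (- (L / 2)) \<le> 1" by (rule one_plus_mult_exp_le)
    then have "L * exp (- (L / 2)) \<le> 2 * (1 - exp (- (L / 2)))" by (simp add: algebra_simps)
    then have "L * exp (- (L / 2)) * (1 - exp (- (L / 2))) \<le> 2 * (1 - exp (- (L / 2))) * (1 - exp (- (L / 2)))"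
      using False by (intro mult_right_mono) auto
    then show ?thesis using False by (simp add: psi'_def power2_eq_square)
  qed (simp add: psi'_def)
qed

text \<open>
  The competition between drift and variation at one point: here \<open>X = |x|\<^sup>2\<close>, \<open>A = f \<psi>(L)\<close>,
  \<open>B = f \<psi>'(L)\<close>, \<open>h\<close> is the Hellinger integrand, \<open>w\<close> the weight, and \<open>u\<close> and \<open>v\<close> are the radial
  posterior means. The first three terms on the right side are the negative of the integrand in the
  dilation identity. The drift \<open>X - u - d\<close> is at least \<open>X / (4 D)\<close> up to \<open>O(D\<^sup>2)\<close>. If
  \<open>X \<ge> 20 D\<^sup>3\<close> then \<open>w\<close> times the drift is at least \<open>1 / (8 D)\<close>. Otherwise it is at
  least \<open>- O(1 / D)\<close> because \<open>w \<le> 1 / D\<^sup>3\<close>, and \<open>A \<le> O(D\<^sup>3) h\<close>, so that the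
  deficit is \<open>O(D\<^sup>2) h\<close>. With a smaller offset in \<open>w\<close> the deficit would exceed this order.
\<close>
lemma flux_bound:
  fixes D X A B u v d h w :: real
  assumes D: "D \<ge> 2" and X: "X \<ge> 0" and h: "h \<ge> 0"
    and A: "0 \<le> A" "A \<le> (X + 3 * D\<^sup>2) * h" and B: "0 \<le> B" "B \<le> 3 * h" and d: "d \<le> D / 2"
    and u: "\<bar>u\<bar> \<le> (1 - 1 / (4 * D)) * X + 2 * D\<^sup>2" and v: "\<bar>v\<bar> \<le> (1 - 1 / (4 * D)) * X + 2 * D\<^sup>2"
    and w: "w = 1 / (X + D ^ 3)"
  shows "A / (8 * D) \<le> w * A * (X - u - d) - w * B * (u - v) + 2 * X * w\<^sup>2 * A + (53 * D\<^sup>2 + 12) * h"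
proof -
  have D23: "D\<^sup>2 * 2 \<le> D ^ 3" "D * 2 \<le> D\<^sup>2" using D by (simp_all add: power2_eq_square power3_eq_cube)
  have D0: "D > 0" "D\<^sup>2 > 0" "D ^ 3 > 0" using D by auto
  have XD: "X + D ^ 3 > 0" using X D0 by (intro add_nonneg_pos)
  have w0: "w > 0" using XD w by simp
  have XX: "(1 - 1 / (4 * D)) * X = X - X / (4 * D)" by (simp add: algebra_simps)
  have XD4: "X / (4 * D) \<ge> 0" using X D0 by simp
  have uv: "\<bar>u - v\<bar> \<le> 4 * (X + D ^ 3)"
  proof -
    have le: "(1 - 1 / (4 * D)) * X + 2 * D\<^sup>2 \<le> X + 2 * D\<^sup>2" unfolding XX using XD4 by simp
    have "\<bar>u - v\<bar> \<le> 4 * X + 4 * D ^ 3"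
      using order_trans[OF u le] order_trans[OF v le] D23(1) X D0(2) by linarith
    then show ?thesis by simp
  qed
  have "\<bar>w * B * (u - v)\<bar> = w * B * \<bar>u - v\<bar>" using w0 B by (simp add: abs_mult)
  also have "\<dots> \<le> w * B * (4 * (X + D ^ 3))"
    using uv w0 B by (intro mult_left_mono) auto
  also have "\<dots> = 4 * B * (w * (X + D ^ 3))" by (simp only: mult_ac)
  also have "w * (X + D ^ 3) = 1" using XD by (simp add: w)
  finally have 1: "w * B * (u - v) \<le> 12 * h" using B by linarith
  have "X - u - d \<ge> X / (4 * D) - 9 / 4 * D\<^sup>2" using u XX D23 d by linarith
  then have 2: "w * A * (X - u - d) \<ge> w * A * (X / (4 * D) - 9 / 4 * D\<^sup>2)"
    using w0 A by (intro mult_left_mono) auto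
  have 3: "2 * X * w\<^sup>2 * A \<ge> 0" using X A by simp
  have 4: "A / (8 * D) \<le> w * A * (X / (4 * D) - 9 / 4 * D\<^sup>2) + 53 * D\<^sup>2 * h"
  proof (cases "X \<ge> 20 * D ^ 3")
    case True
    have "19 * D ^ 3 \<le> X" using True D0(3) by linarith
    then have "(X + D ^ 3) / (8 * D) \<le> X / (4 * D) - 9 / 4 * D\<^sup>2"
      using D0 by (simp add: field_simps power2_eq_square power3_eq_cube)
    then have "w * A * ((X + D ^ 3) / (8 * D)) \<le> w * A * (X / (4 * D) - 9 / 4 * D\<^sup>2)"
      using w0 A by (intro mult_left_mono) auto
    moreover have "w * A * ((X + D ^ 3) / (8 * D)) = A / (8 * D)" using XD by (simp add: w)
    ultimately show ?thesis using h D0 by (smt (verit) mult_nonneg_nonneg)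
  next
    case False
    have "X + 3 * D\<^sup>2 \<le> 22 * D ^ 3" using False D23 D0 by linarith
    then have A22: "A \<le> 22 * D ^ 3 * h" using A h by (meson mult_right_mono order_trans)
    have "w \<le> 1 / D ^ 3" unfolding w using X D0(3) XD by (intro divide_left_mono mult_pos_pos) auto
    then have "w * A * (9 / 4 * D\<^sup>2) \<le> 1 / D ^ 3 * A * (9 / 4 * D\<^sup>2)"
      using A D0 by (intro mult_right_mono) auto
    also have "\<dots> = 9 / 4 * (A / D)" using D0 by (simp add: power2_eq_square power3_eq_cube)
    finally have "A / (8 * D) + w * A * (9 / 4 * D\<^sup>2) \<le> 19 / 8 * (A / D)" by simp
    also have "A / D \<le> 22 * D\<^sup>2 * h"
      using A22 D0 by (simp add: divide_le_eq power2_eq_square power3_eq_cube mult_ac)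
    also have "19 / 8 * (22 * D\<^sup>2 * h) \<le> 53 * D\<^sup>2 * h" using h D0 by simp
    finally have "A / (8 * D) + w * A * (9 / 4 * D\<^sup>2) \<le> 53 * D\<^sup>2 * h" by simp
    moreover have "w * A * (X / (4 * D)) \<ge> 0"
      using w0 A(1) XD4 by (intro mult_nonneg_nonneg[of "w * A"] mult_nonneg_nonneg[of w]) (simp_all only: less_imp_le)
    ultimately show ?thesis by (simp add: right_diff_distrib)
  qed
  have "A / (8 * D) + w * B * (u - v)
      \<le> w * A * (X - u - d) + 2 * X * w\<^sup>2 * A + (53 * D\<^sup>2 * h + 12 * h)"
    using order_trans[OF 4 add_right_mono[OF 2]] 1 3 by linarith
  then show ?thesis unfolding distrib_right by linarith
qed

section \<open>Comparing two mixtures\<close>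
locale subgaussian_pair = P: subgaussian_prior \<pi> D + Q: subgaussian_prior \<eta> D
  for \<pi> \<eta> :: "(real ^ 'n) measure" and D :: real +
  assumes dim_le: "real CARD('n) \<le> D / 2"
begin

abbreviation f :: "real ^ 'n \<Rightarrow> real" where "f \<equiv> gauss_mixture \<pi>"
abbreviation g :: "real ^ 'n \<Rightarrow> real" where "g \<equiv> gauss_mixture \<eta>"

definition llr :: "real ^ 'n \<Rightarrow> real" where "llr x = ln (f x) - ln (g x)"

definition hel :: "real ^ 'n \<Rightarrow> real" where "hel x = (sqrt (f x) - sqrt (g x))\<^sup>2"

lemma llr_hel_measurable [measurable]: "llr \<in> borel_measurable borel" "hel \<in> borel_measurable borel"
  unfolding llr_def[abs_def] hel_def[abs_def] by measurable

lemma exp_llr: "exp (- llr x) = g x / f x"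
  using P.mixture_pos[of x] Q.mixture_pos[of x] by (simp add: llr_def exp_diff)

lemma hel_eq: "hel x = f x * (1 - exp (- (llr x / 2)))\<^sup>2"
proof -
  have "(exp (- (llr x / 2)))\<^sup>2 = g x / f x"
    unfolding exp_llr[symmetric] by (simp add: power2_eq_square exp_add[symmetric])
  then have "exp (- (llr x / 2)) = sqrt (g x / f x)"
    by (metis exp_ge_zero real_sqrt_unique)
  then have "sqrt (f x) * (1 - exp (- (llr x / 2))) = sqrt (f x) - sqrt (g x)"
    using P.mixture_pos[of x] by (simp add: real_sqrt_divide field_simps)
  then have "hel x = (sqrt (f x) * (1 - exp (- (llr x / 2))))\<^sup>2" by (simp add: hel_def)
  then show ?thesis using P.mixture_pos[of x] by (simp add: power_mult_distrib)
qed

lemma hel_nonneg: "hel x \<ge> 0" by (simp add: hel_def)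

lemma hel_le: "hel x \<le> f x + g x"
proof -
  have "hel x = f x + g x - 2 * (sqrt (f x) * sqrt (g x))"
    using P.mixture_pos[of x] Q.mixture_pos[of x]
    by (simp add: hel_def power2_diff less_imp_le)
  then show ?thesis using P.mixture_pos[of x] Q.mixture_pos[of x] by (simp add: less_imp_le)
qed

lemma ln_mixture_bounds:
  fixes \<mu> \<nu> :: "(real ^ 'n) measure"
  assumes "subgaussian_prior \<mu> D" and "subgaussian_prior \<nu> D"
  shows "ln (gauss_mixture \<mu> x) - ln (gauss_mixture \<nu> x) \<le> (norm x)\<^sup>2 + 3 * D\<^sup>2"
proof -
  interpret M: subgaussian_prior \<mu> D by fact
  interpret N: subgaussian_prior \<nu> D by fact
  let ?c = "gauss_const TYPE('n)"
  let ?e = "(1 + 1 / (2 * D)) * (norm x)\<^sup>2 / 2 + (1 + 2 * D) * D"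
  have "ln (gauss_mixture \<mu> x) \<le> ln ?c" using M.mixture_le[of x] M.mixture_pos[of x]
    by (subst ln_le_cancel_iff) auto
  moreover have "ln (?c * exp (- ?e)) \<le> ln (gauss_mixture \<nu> x)"
    using N.mixture_ge[of x] N.mixture_pos[of x] by (subst ln_le_cancel_iff) auto
  moreover have "ln (?c * exp (- ?e)) = ln ?c - ?e" by (simp add: ln_mult)
  moreover have "?e \<le> (norm x)\<^sup>2 + 3 * D\<^sup>2"
  proof -
    have "(1 + 1 / (2 * D)) * (norm x)\<^sup>2 / 2 \<le> 2 * (norm x)\<^sup>2 / 2"
      using M.D2 by (intro divide_right_mono mult_right_mono) auto
    then have "(1 + 1 / (2 * D)) * (norm x)\<^sup>2 / 2 \<le> (norm x)\<^sup>2" by simp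
    moreover have "(1 + 2 * D) * D \<le> 3 * D\<^sup>2" using M.D2 by (simp add: power2_eq_square algebra_simps)
    ultimately show ?thesis by (rule add_mono)
  qed
  ultimately show ?thesis by linarith
qed

lemma abs_llr_le: "\<bar>llr x\<bar> \<le> (norm x)\<^sup>2 + 3 * D\<^sup>2"
  using ln_mixture_bounds[OF P.subgaussian_prior_axioms Q.subgaussian_prior_axioms, of x]
    ln_mixture_bounds[OF Q.subgaussian_prior_axioms P.subgaussian_prior_axioms, of x]
  unfolding llr_def by linarith

text \<open>Everything integrated below is at most \<open>1 + |x|\<^sup>2\<close> times the Hellinger integrand, hence at most
  a multiple of \<open>(1 + |x|\<^sup>2) (f + g)\<close>.\<close>
lemma integrable_of_hel_bound:
  assumes [measurable]: "F \<in> borel_measurable borel"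
    and le: "\<And>x. \<bar>F x\<bar> \<le> C * (1 + (norm x)\<^sup>2) * hel x" and C: "C \<ge> 0"
  shows "integrable lborel F"
proof (rule Bochner_Integration.integrable_bound)
  show "integrable lborel (\<lambda>x. C * ((1 + (norm x)\<^sup>2) * f x + (1 + (norm x)\<^sup>2) * g x))"
    using P.integrable_mixture_weighted Q.integrable_mixture_weighted by simp
  have "\<bar>F x\<bar> \<le> C * ((1 + (norm x)\<^sup>2) * f x + (1 + (norm x)\<^sup>2) * g x)" for x
  proof -
    have "C * (1 + (norm x)\<^sup>2) * hel x \<le> C * (1 + (norm x)\<^sup>2) * (f x + g x)"
      using C by (intro mult_left_mono hel_le) auto
    then show ?thesis using le[of x] by (simp add: algebra_simps)
  qed
  then show "AE x in lborel. norm (F x) \<le> norm (C * ((1 + (norm x)\<^sup>2) * f x + (1 + (norm x)\<^sup>2) * g x))"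
    by (intro AE_I2) (auto intro: order_trans[OF _ abs_ge_self])
qed measurable

lemma integrable_hel: "integrable lborel hel"
  by (rule integrable_of_hel_bound[of _ 1])
     (use hel_nonneg in \<open>auto simp: algebra_simps\<close>)

definition wt :: "real ^ 'n \<Rightarrow> real" where "wt x = 1 / ((norm x)\<^sup>2 + D ^ 3)"

text \<open>The function to which the dilation identity is applied, and its radial derivative.\<close>
definition pot :: "real ^ 'n \<Rightarrow> real" where "pot x = wt x * (f x * psi (llr x))"

definition pot_euler :: "real ^ 'n \<Rightarrow> real" where
  "pot_euler x = wt x * (f x * psi (llr x)) * (P.posterior_inner x - (norm x)\<^sup>2)
     + wt x * (f x * psi' (llr x)) * (P.posterior_inner x - Q.posterior_inner x)
     - 2 * (norm x)\<^sup>2 * (wt x)\<^sup>2 * (f x * psi (llr x))"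

lemma pot_measurable [measurable]:
  "wt \<in> borel_measurable borel" "pot \<in> borel_measurable borel" "pot_euler \<in> borel_measurable borel"
proof -
  show [measurable]: "wt \<in> borel_measurable borel" unfolding wt_def[abs_def] by measurable
  show "pot \<in> borel_measurable borel" "pot_euler \<in> borel_measurable borel"
    unfolding pot_def[abs_def] pot_euler_def[abs_def] by measurable
qed

lemma wt_denominator_pos: "(norm x)\<^sup>2 + D ^ 3 > 0" for x :: "real ^ 'n"
  using P.D2 by (intro add_nonneg_pos) auto

lemma euler_pot: "euler_deriv pot pot_euler"
  unfolding euler_deriv_def
proof
  fix x :: "real ^ 'n"
  let ?df = "f x * (P.posterior_inner x - (norm x)\<^sup>2)"
  let ?dg = "g x * (Q.posterior_inner x - (norm x)\<^sup>2)"
  have fp: "f x > 0" and gp: "g x > 0" using P.mixture_pos Q.mixture_pos by auto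
  have df: "((\<lambda>s. f (s *\<^sub>R x)) has_real_derivative ?df) (at 1)"
    and dg: "((\<lambda>s. g (s *\<^sub>R x)) has_real_derivative ?dg) (at 1)"
    using P.euler_mixture Q.euler_mixture by (auto simp: euler_deriv_def)
  have "((\<lambda>s. llr (s *\<^sub>R x)) has_real_derivative ?df / f x - ?dg / g x) (at 1)"
    unfolding llr_def using fp gp by (auto intro!: derivative_eq_intros df dg simp: field_simps)
  then have dl: "((\<lambda>s. llr (s *\<^sub>R x)) has_real_derivative P.posterior_inner x - Q.posterior_inner x) (at 1)"
    using fp gp by simp
  have dpsi: "((\<lambda>s. psi (llr (s *\<^sub>R x))) has_real_derivative
      psi' (llr x) * (P.posterior_inner x - Q.posterior_inner x)) (at 1)"
    using DERIV_chain2[OF psi_deriv dl] by simp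
  have dw: "((\<lambda>s. wt (s *\<^sub>R x)) has_real_derivative - (2 * (norm x)\<^sup>2 * (wt x)\<^sup>2)) (at 1)"
  proof -
    have "x \<bullet> x + D ^ 3 \<noteq> 0" using wt_denominator_pos[of x] by (simp add: power2_norm_eq_inner)
    then show ?thesis
      unfolding wt_def power2_norm_eq_inner
      by (auto intro!: derivative_eq_intros simp: power2_eq_square)
  qed
  have "((\<lambda>s. wt (s *\<^sub>R x) * (f (s *\<^sub>R x) * psi (llr (s *\<^sub>R x)))) has_real_derivative pot_euler x) (at 1)"
    by (auto intro!: derivative_eq_intros df dw dpsi simp: pot_euler_def algebra_simps)
  then show "((\<lambda>s. pot (s *\<^sub>R x)) has_real_derivative pot_euler x) (at 1)"
    unfolding pot_def .
qed

lemma psi_llr: "f x * psi (llr x) = max 0 (llr x) * hel x"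
  by (simp add: psi_def hel_eq)

lemma psi_llr_bounds: "0 \<le> max 0 (llr x) * hel x" "max 0 (llr x) * hel x \<le> ((norm x)\<^sup>2 + 3 * D\<^sup>2) * hel x"
proof -
  show "0 \<le> max 0 (llr x) * hel x" using hel_nonneg by simp
  have "max 0 (llr x) \<le> (norm x)\<^sup>2 + 3 * D\<^sup>2" using abs_llr_le[of x] by simp
  then show "max 0 (llr x) * hel x \<le> ((norm x)\<^sup>2 + 3 * D\<^sup>2) * hel x"
    by (rule mult_right_mono) (rule hel_nonneg)
qed

lemma psi'_llr_bounds: "0 \<le> f x * psi' (llr x)" "f x * psi' (llr x) \<le> 3 * hel x"
  using psi'_bounds[of "llr x"] P.mixture_pos[of x] unfolding hel_eq
  by (auto simp: mult.left_commute[of 3])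

lemma integrable_pos_llr: "integrable lborel (\<lambda>x. max 0 (llr x) * hel x)"
proof (rule integrable_of_hel_bound[of _ "3 * D\<^sup>2"])
  show "\<bar>max 0 (llr x) * hel x\<bar> \<le> 3 * D\<^sup>2 * (1 + (norm x)\<^sup>2) * hel x" for x
  proof -
    have "1 \<le> D\<^sup>2" using P.D2 by (simp add: one_le_power)
    then have "1 * (norm x)\<^sup>2 \<le> 3 * D\<^sup>2 * (norm x)\<^sup>2" by (intro mult_right_mono) auto
    then have "(norm x)\<^sup>2 + 3 * D\<^sup>2 \<le> 3 * D\<^sup>2 * (1 + (norm x)\<^sup>2)" by (simp add: algebra_simps)
    then have "((norm x)\<^sup>2 + 3 * D\<^sup>2) * hel x \<le> 3 * D\<^sup>2 * (1 + (norm x)\<^sup>2) * hel x"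
      by (rule mult_right_mono) (rule hel_nonneg)
    then show ?thesis using psi_llr_bounds[of x] by simp
  qed
qed auto

lemma wt_bounds: "wt x > 0" "wt x * ((norm x)\<^sup>2 + 3 * D\<^sup>2) \<le> 2" "wt x * (norm x)\<^sup>2 \<le> 1"
  "wt x * (2 * (norm x)\<^sup>2 + 4 * D\<^sup>2) \<le> 4"
proof -
  have "D\<^sup>2 * 2 \<le> D ^ 3" using P.D2 by (simp add: power2_eq_square power3_eq_cube)
  then have "3 * D\<^sup>2 \<le> (norm x)\<^sup>2 + 2 * D ^ 3" "4 * D\<^sup>2 \<le> 2 * (norm x)\<^sup>2 + 4 * D ^ 3" "D \<ge> 0"
    using zero_le_power2[of D] zero_le_power2[of "norm x"] P.D2 by linarith+
  then show "wt x > 0" "wt x * ((norm x)\<^sup>2 + 3 * D\<^sup>2) \<le> 2" "wt x * (norm x)\<^sup>2 \<le> 1"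
    "wt x * (2 * (norm x)\<^sup>2 + 4 * D\<^sup>2) \<le> 4"
    using wt_denominator_pos[of x] by (auto simp: wt_def divide_le_eq)
qed

lemma pot_bounds: "0 \<le> pot x" "pot x \<le> 2 * hel x"
proof -
  show "0 \<le> pot x" unfolding pot_def psi_llr using psi_llr_bounds wt_bounds(1)[of x] by simp
  have "wt x * (max 0 (llr x) * hel x) \<le> wt x * (((norm x)\<^sup>2 + 3 * D\<^sup>2) * hel x)"
    using psi_llr_bounds wt_bounds(1)[of x] by (intro mult_left_mono) auto
  also have "\<dots> = wt x * ((norm x)\<^sup>2 + 3 * D\<^sup>2) * hel x" by simp
  also have "\<dots> \<le> 2 * hel x" using wt_bounds(2) hel_nonneg by (intro mult_right_mono)
  finally show "pot x \<le> 2 * hel x" unfolding pot_def psi_llr .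
qed

lemma posterior_bounds:
  "\<bar>P.posterior_inner x\<bar> \<le> (norm x)\<^sup>2 + 2 * D\<^sup>2" "\<bar>Q.posterior_inner x\<bar> \<le> (norm x)\<^sup>2 + 2 * D\<^sup>2"
proof -
  have "(1 - 1 / (4 * D)) * (norm x)\<^sup>2 \<le> 1 * (norm x)\<^sup>2"
    using P.D2 by (intro mult_right_mono) auto
  then show "\<bar>P.posterior_inner x\<bar> \<le> (norm x)\<^sup>2 + 2 * D\<^sup>2" "\<bar>Q.posterior_inner x\<bar> \<le> (norm x)\<^sup>2 + 2 * D\<^sup>2"
    using P.posterior_inner_bound[of x] Q.posterior_inner_bound[of x] by linarith+
qed

lemma integrable_pot: "integrable lborel pot"
proof (rule integrable_of_hel_bound[of _ 2])
  show "\<bar>pot x\<bar> \<le> 2 * (1 + (norm x)\<^sup>2) * hel x" for x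
    using pot_bounds[of x] hel_nonneg[of x] by (simp add: algebra_simps add_increasing2)
qed auto

lemma integrable_pot_euler: "integrable lborel pot_euler"
proof (rule integrable_of_hel_bound[of _ "4 * D\<^sup>2 + 16"])
  fix x :: "real ^ 'n"
  define X where "X = (norm x)\<^sup>2"
  have X0: "X \<ge> 0" by (simp add: X_def)
  let ?u = "P.posterior_inner x" and ?v = "Q.posterior_inner x"
  note u = posterior_bounds[of x, folded X_def]
  note W = wt_bounds[of x, folded X_def]
  have e: "pot_euler x = pot x * (?u - X) + wt x * (f x * psi' (llr x)) * (?u - ?v) - 2 * (wt x * X) * pot x"
    by (simp add: pot_euler_def pot_def X_def power2_eq_square)
  have 1: "\<bar>pot x * (?u - X)\<bar> \<le> 2 * hel x * (2 * X + 2 * D\<^sup>2)"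
    unfolding abs_mult using pot_bounds[of x] u X0 hel_nonneg[of x] by (intro mult_mono) auto
  have "\<bar>wt x * (f x * psi' (llr x)) * (?u - ?v)\<bar> = (f x * psi' (llr x)) * (wt x * \<bar>?u - ?v\<bar>)"
    using psi'_llr_bounds(1)[of x] W(1) P.mixture_pos[of x] psi'_bounds(1)[of "llr x"] by (simp add: abs_mult)
  also have "\<dots> \<le> (3 * hel x) * 4"
  proof (rule mult_mono)
    have "wt x * \<bar>?u - ?v\<bar> \<le> wt x * (2 * X + 4 * D\<^sup>2)"
      using u W(1) by (intro mult_left_mono) auto
    then show "wt x * \<bar>?u - ?v\<bar> \<le> 4" using W(4) by linarith
  qed (use psi'_llr_bounds W(1) hel_nonneg in auto)
  finally have 2: "\<bar>wt x * (f x * psi' (llr x)) * (?u - ?v)\<bar> \<le> 12 * hel x" by simp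
  have "(wt x * X) * pot x \<le> 1 * (2 * hel x)"
    using W(3) pot_bounds[of x] by (intro mult_mono) auto
  moreover have "0 \<le> (wt x * X) * pot x" using W(1) X0 pot_bounds(1)[of x] by simp
  ultimately have 3: "\<bar>2 * (wt x * X) * pot x\<bar> \<le> 4 * hel x" by simp
  have "\<bar>pot_euler x\<bar> \<le> 2 * hel x * (2 * X + 2 * D\<^sup>2) + 12 * hel x + 4 * hel x"
    unfolding e using 1 2 3 by linarith
  also have "\<dots> = (4 * X + 4 * D\<^sup>2 + 16) * hel x" by (simp add: algebra_simps)
  also have "\<dots> \<le> (4 * D\<^sup>2 + 16) * (1 + X) * hel x"
  proof (rule mult_right_mono)
    have "0 \<le> D\<^sup>2 * X" using X0 by simp
    moreover have "(4 * D\<^sup>2 + 16) * (1 + X) = 4 * D\<^sup>2 + 16 + 4 * (D\<^sup>2 * X) + 16 * X"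
      by (simp add: algebra_simps)
    ultimately show "4 * X + 4 * D\<^sup>2 + 16 \<le> (4 * D\<^sup>2 + 16) * (1 + X)" using X0 by linarith
  qed (rule hel_nonneg)
  finally show "\<bar>pot_euler x\<bar> \<le> (4 * D\<^sup>2 + 16) * (1 + (norm x)\<^sup>2) * hel x" unfolding X_def .
qed auto

text \<open>
  Integrating \<open>flux_bound\<close> over the whole space, where the dilation identity removes the flux.
\<close>
theorem hellinger_log_moment:
  "(LINT x|lborel. max 0 (llr x) * hel x) \<le> 8 * D * (53 * D\<^sup>2 + 12) * (LINT x|lborel. hel x)"
proof -
  let ?C = "53 * D\<^sup>2 + 12"
  have D0: "D > 0" using P.D2 by simp
  have le: "max 0 (llr x) * hel x / (8 * D) \<le> ?C * hel x - (real DIM(real ^ 'n) * pot x + pot_euler x)" for x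
  proof -
    have "max 0 (llr x) * hel x / (8 * D) \<le>
        wt x * (max 0 (llr x) * hel x) * ((norm x)\<^sup>2 - P.posterior_inner x - real CARD('n))
        - wt x * (f x * psi' (llr x)) * (P.posterior_inner x - Q.posterior_inner x)
        + 2 * (norm x)\<^sup>2 * (wt x)\<^sup>2 * (max 0 (llr x) * hel x) + ?C * hel x"
      using flux_bound[OF P.D2 zero_le_power2[of "norm x"] hel_nonneg[of x] psi_llr_bounds[of x]
          psi'_llr_bounds[of x] dim_le P.posterior_inner_bound[of x] Q.posterior_inner_bound[of x] wt_def[of x]] .
    also have "\<dots> = ?C * hel x - (real DIM(real ^ 'n) * pot x + pot_euler x)"
      by (simp add: pot_def pot_euler_def psi_llr algebra_simps)
    finally show ?thesis .
  qed
  have "(LINT x|lborel. max 0 (llr x) * hel x / (8 * D)) \<le>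
      (LINT x|lborel. ?C * hel x - (real DIM(real ^ 'n) * pot x + pot_euler x))"
    by (intro integral_mono le integrable_divide_zero integrable_pos_llr Bochner_Integration.integrable_diff
        Bochner_Integration.integrable_add integrable_mult_right integrable_hel integrable_pot integrable_pot_euler)
  also have "\<dots> = ?C * (LINT x|lborel. hel x) - (LINT x|lborel. real DIM(real ^ 'n) * pot x + pot_euler x)"
    by (subst Bochner_Integration.integral_diff)
       (auto intro!: integrable_hel integrable_pot integrable_pot_euler)
  also have "\<dots> = ?C * (LINT x|lborel. hel x)"
    unfolding dilation_identity[OF integrable_pot integrable_pot_euler euler_pot] by simp
  finally show ?thesis using D0 by (simp add: divide_le_eq mult_ac)
qed

theorem KL_le: "KL_div f g \<le> ereal (460 * D ^ 3 * hellinger_sq f g)"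
proof -
  have ln_eq: "ln (f x / g x) = llr x" for x
    using P.mixture_pos[of x] Q.mixture_pos[of x] by (simp add: llr_def ln_div)
  have int: "integrable lborel (\<lambda>x. f x * llr x)"
  proof (rule Bochner_Integration.integrable_bound)
    show "integrable lborel (\<lambda>x. 3 * D\<^sup>2 * ((1 + (norm x)\<^sup>2) * f x))"
      using P.integrable_mixture_weighted by simp
    have "\<bar>f x * llr x\<bar> \<le> 3 * D\<^sup>2 * ((1 + (norm x)\<^sup>2) * f x)" for x
    proof -
      have "1 \<le> D\<^sup>2" using P.D2 by (simp add: one_le_power)
      then have "1 * (norm x)\<^sup>2 \<le> 3 * D\<^sup>2 * (norm x)\<^sup>2" by (intro mult_right_mono) auto
      then have "\<bar>llr x\<bar> \<le> 3 * D\<^sup>2 * (1 + (norm x)\<^sup>2)" using abs_llr_le[of x] by (simp add: algebra_simps)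
      then have "f x * \<bar>llr x\<bar> \<le> f x * (3 * D\<^sup>2 * (1 + (norm x)\<^sup>2))"
        using P.mixture_pos[of x] by (intro mult_left_mono) auto
      then show ?thesis using P.mixture_pos[of x] by (simp add: abs_mult mult_ac)
    qed
    then show "AE x in lborel. norm (f x * llr x) \<le> norm (3 * D\<^sup>2 * ((1 + (norm x)\<^sup>2) * f x))"
      by (intro AE_I2) (auto intro: order_trans[OF _ abs_ge_self])
  qed measurable
  have "KL_div f g = ereal (LINT x|lborel. f x * llr x)"
    using KL_div_eq_integral[of g f] Q.mixture_pos int by (simp add: ln_eq)
  moreover have "(LINT x|lborel. f x * llr x) \<le> 460 * D ^ 3 * hellinger_sq f g"
  proof -
    have le: "f x * llr x - f x + g x \<le> 3 * hel x + max 0 (llr x) * hel x" for x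
    proof -
      have "f x * (llr x - 1 + exp (- llr x)) \<le> f x * ((3 + max 0 (llr x)) * (1 - exp (- (llr x / 2)))\<^sup>2)"
        using P.mixture_pos[of x] by (intro mult_left_mono kl_le_hellinger_weighted) auto
      moreover have "f x * (llr x - 1 + exp (- llr x)) = f x * llr x - f x + g x"
        using P.mixture_pos[of x] by (simp add: exp_llr algebra_simps)
      ultimately show ?thesis by (simp add: hel_eq algebra_simps)
    qed
    have "(LINT x|lborel. f x * llr x) = (LINT x|lborel. f x * llr x - f x + g x)"
      using int P.integrable_mixture Q.integrable_mixture P.integral_mixture Q.integral_mixture by simp
    also have "\<dots> \<le> (LINT x|lborel. 3 * hel x + max 0 (llr x) * hel x)"
      by (intro integral_mono le Bochner_Integration.integrable_diff Bochner_Integration.integrable_add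
          int P.integrable_mixture Q.integrable_mixture integrable_mult_right integrable_hel integrable_pos_llr)
    also have "\<dots> = 3 * (LINT x|lborel. hel x) + (LINT x|lborel. max 0 (llr x) * hel x)"
      using integrable_hel integrable_pos_llr by simp
    also have "\<dots> \<le> (3 + 8 * D * (53 * D\<^sup>2 + 12)) * (LINT x|lborel. hel x)"
      using hellinger_log_moment by (simp add: distrib_right)
    also have "\<dots> \<le> 460 * D ^ 3 * (LINT x|lborel. hel x)"
    proof (rule mult_right_mono)
      have "D * 4 \<le> D ^ 3" "1 \<le> D ^ 3" "8 \<le> D ^ 3"
        using P.D2 power_mono[of 2 D 2] power_mono[of 2 D 3] by (auto simp: power2_eq_square power3_eq_cube)
      then show "3 + 8 * D * (53 * D\<^sup>2 + 12) \<le> 460 * D ^ 3"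
        by (simp add: algebra_simps power2_eq_square power3_eq_cube)
    qed (simp add: hel_nonneg)
    finally show ?thesis unfolding hellinger_sq_def hel_def .
  qed
  ultimately show ?thesis by simp
qed

end

section \<open>The comparison theorem\<close>
lemma subgaussian_mono:
  assumes "subgaussian K \<pi>" "0 < K" "K \<le> K'"
  shows "subgaussian K' \<pi>"
  unfolding subgaussian_def
proof (intro allI impI)
  fix t :: real assume t: "t \<ge> 0"
  have "t\<^sup>2 / (2 * K'\<^sup>2) \<le> t\<^sup>2 / (2 * K\<^sup>2)"
    using assms(2,3) by (intro divide_left_mono mult_left_mono power_mono) auto
  then have "exp (- (t\<^sup>2 / (2 * K\<^sup>2))) \<le> exp (- (t\<^sup>2 / (2 * K'\<^sup>2)))" by simp
  then show "measure \<pi> {x. t < norm x} \<le> exp (- (t\<^sup>2 / (2 * K'\<^sup>2)))"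
    using assms(1) t unfolding subgaussian_def by (meson order_trans)
qed

theorem theorem4:
  fixes \<pi> \<eta> :: "(real ^ 'n) measure" and K :: real
  assumes "0 < K" and "K < 1"
    and "prob_space \<pi>" and "sets \<pi> = sets borel"
    and "prob_space \<eta>" and "sets \<eta> = sets borel"
    and "subgaussian K \<pi>" and "subgaussian K \<eta>"
  shows "KL_div (gauss_mixture \<pi>) (gauss_mixture \<eta>) \<le>
    ereal (1660056 * max (1 / (1 - K) ^ 3) (8 * real CARD('n) ^ 3) *
      hellinger_sq (gauss_mixture \<pi>) (gauss_mixture \<eta>))"
proof -
  define D where "D = max (1 / (1 - K)) (2 * real CARD('n))"
  have card: "1 \<le> real CARD('n)" by (simp add: Suc_le_eq)
  have D2: "2 \<le> D" using card unfolding D_def by linarith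
  have "1 / (1 - K) \<le> D" by (simp add: D_def)
  then have K: "K \<le> 1 - 1 / D" using D2 assms(2) by (simp add: field_simps)
  have prior: "subgaussian_prior \<pi> D" "subgaussian_prior \<eta> D"
    using assms(3-6) D2 subgaussian_mono[OF assms(7,1) K] subgaussian_mono[OF assms(8,1) K]
    by (simp_all add: subgaussian_prior_def subgaussian_prior_axioms_def)
  have "2 * real CARD('n) \<le> D" by (simp add: D_def)
  then interpret subgaussian_pair \<pi> \<eta> D
    using prior by (simp add: subgaussian_pair_def subgaussian_pair_axioms_def)
  have D3: "D ^ 3 \<le> max (1 / (1 - K) ^ 3) (8 * real CARD('n) ^ 3)"
    by (cases "1 / (1 - K) \<le> 2 * real CARD('n)") (auto simp: D_def power_divide power_mult_distrib max_def)
  have "460 * D ^ 3 * hellinger_sq (gauss_mixture \<pi>) (gauss_mixture \<eta>) \<le>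
      1660056 * max (1 / (1 - K) ^ 3) (8 * real CARD('n) ^ 3) *
      hellinger_sq (gauss_mixture \<pi>) (gauss_mixture \<eta>)"
    using D3 D2 by (intro mult_right_mono mult_mono) (auto simp: hellinger_sq_def)
  then show ?thesis using KL_le by (meson ereal_less_eq(3) order_trans)
qed

end
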